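(* Let $\mathbb{K}$ be a field of characteristic zero and let $\mathcal{D}\subset\mathbb{Z}_+^3$ be a three-dimensional Ferrers diagram which satisfies the projection property or is lexicographically quadratic. Then the 2-minors ideal $\mathbf{I}_2(\mathcal{D})$ is lexicographically quadratic.
   Context: $\mathbb{Z}_+$ denotes the positive integers. A three-dimensional Ferrers diagram is a finite nonempty set $\mathcal{D}\subset\mathbb{Z}_+^3$ such that whenever $(i_0,j_0,k_0)\in\mathcal{D}$ and $i\le i_0$, $j\le j_0$, $k\le k_0$ are positive integers, then $(i,j,k)\in\mathcal{D}$. Let $a_{\mathcal{D}}$ be the number of distinct first coordinates of points of $\mathcal{D}$. $\mathcal{D}$ satisfies the projection property if for every $2\le i\le a_{\mathcal{D}}$ one has $(i-1,b_i,c_i)\in\mathcal{D}$, where $b_i=\max\{j:(i,j,1)\in\mathcal{D}\}$ and $c_i=\max\{k:(i,1,k)\in\mathcal{D}\}$. Let $\mathbb{K}[\mathbf{T}_{\mathcal{D}}]=\mathbb{K}[T_{\boldsymbol u}:\boldsymbol u\in\mathcal{D}]$, and let $J_{\mathcal{D}}$ (the special fiber ideal) be the kernel of the $\mathbb{K}$-algebra map from $\mathbb{K}[\mathbf{T}_{\mathcal{D}}]$ to the polynomial ring in variables $x_i,y_j,z_k$ given by $T_{i,j,k}\mapsto x_iy_jz_k$. For $\boldsymbol u=(i_1,j_1,k_1)$, $\boldsymbol v=(i_2,j_2,k_2)$ in $\mathcal{D}$ put $\mathbf{I}_{2,x}(\boldsymbol u,\boldsymbol v)=T_{\boldsymbol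 u}T_{\boldsymbol v}-T_{i_2,j_1,k_1}T_{i_1,j_2,k_2}$ if both $(i_2,j_1,k_1),(i_1,j_2,k_2)\in\mathcal{D}$, and $0$ otherwise; $\mathbf{I}_{2,y}$ and $\mathbf{I}_{2,z}$ are defined analogously by switching the second, respectively third, coordinates. The 2-minors ideal $\mathbf{I}_2(\mathcal{D})\subset\mathbb{K}[\mathbf{T}_{\mathcal{D}}]$ is generated by all these binomials, $\boldsymbol u,\boldsymbol v\in\mathcal{D}$. Variables are ordered by $T_{i,j,k}>T_{i',j',k'}$ iff $(i,j,k)$ precedes $(i',j',k')$ lexicographically (so $T_{1,1,1}$ is the largest), and monomials are ordered by the induced lexicographic order. A binomial ideal is lexicographically quadratic if all elements of its minimal Gr\"obner basis with respect to this lexicographic order are quadratic; the diagram $\mathcal{D}$ is called lexicographically quadratic if $J_{\mathcal{D}}$ is. *)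

theory Defs
  imports "HOL-Library.Poly_Mapping" "HOL-Library.Product_Lexorder"
begin

section \<open>Polynomials\<close>

text \<open>Monomials are finitely supported exponent vectors, and polynomials are finitely supported
  families of coefficients indexed by monomials; the ring structure is that of
  \<^theory>\<open>HOL-Library.Poly_Mapping\<close>.\<close>

type_synonym 'v mono = "'v \<Rightarrow>\<^sub>0 nat"
type_synonym ('v, 'k) mpoly = "'v mono \<Rightarrow>\<^sub>0 'k"

definition const :: "'k \<Rightarrow> ('v, 'k::zero) mpoly" where
  "const c = Poly_Mapping.single 0 c"

definition var :: "'v \<Rightarrow> ('v, 'k::zero_neq_one) mpoly" where
  "var v = Poly_Mapping.single (Poly_Mapping.single v 1) 1"

definition polys_over :: "'v set \<Rightarrow> ('v, 'k::zero) mpoly set" where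
  "polys_over V = {p. \<forall>m\<in>Poly_Mapping.keys p. Poly_Mapping.keys m \<subseteq> V}"

definition eval_hom :: "('v \<Rightarrow> ('w, 'k) mpoly) \<Rightarrow> ('v, 'k::comm_ring_1) mpoly \<Rightarrow> ('w, 'k) mpoly" where
  "eval_hom f p = (\<Sum>m\<in>Poly_Mapping.keys p. const (Poly_Mapping.lookup p m) *
     (\<Prod>v\<in>Poly_Mapping.keys m. f v ^ Poly_Mapping.lookup m v))"

text \<open>The ideal generated by \<open>B\<close> in the polynomial ring in the variables \<open>V\<close>; the cofactors must
  not involve other variables.\<close>

definition ideal_gen :: "'v set \<Rightarrow> ('v, 'k::comm_ring_1) mpoly set \<Rightarrow> ('v, 'k) mpoly set" where
  "ideal_gen V B =
     {(\<Sum>b\<in>A. q b * b) | A q. finite A \<and> A \<subseteq> B \<and> (\<forall>b\<in>A. q b \<in> polys_over V)}"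

definition mono_dvd :: "'v mono \<Rightarrow> 'v mono \<Rightarrow> bool" where
  "mono_dvd s t \<longleftrightarrow> (\<exists>r. t = s + r)"

definition mono_degree :: "'v mono \<Rightarrow> nat" where
  "mono_degree m = (\<Sum>v\<in>Poly_Mapping.keys m. Poly_Mapping.lookup m v)"

definition quadratic :: "('v, 'k::zero) mpoly \<Rightarrow> bool" where
  "quadratic p \<longleftrightarrow> p \<noteq> 0 \<and> (\<forall>m\<in>Poly_Mapping.keys p. mono_degree m = 2)"


section \<open>Groebner bases for the lexicographic order\<close>

text \<open>The library order on finitely supported functions compares two exponent vectors at the
  \<^emph>\<open>smallest\<close> variable where they differ, and the one with the larger exponent there is larger.
  It is thus the lexicographic order in which smaller elements of the index type are larger as
  variables.\<close>

lemma mono_less_iff: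
  "(s :: 'v::linorder mono) < t \<longleftrightarrow>
     (\<exists>v. Poly_Mapping.lookup s v < Poly_Mapping.lookup t v \<and>
        (\<forall>w<v. Poly_Mapping.lookup s w = Poly_Mapping.lookup t w))"
  by transfer (simp add: less_fun_def)

lemma single_less_single_iff:
  "Poly_Mapping.single (v::'v::linorder) (1::nat) < Poly_Mapping.single w 1 \<longleftrightarrow> w < v"
  by (auto simp: mono_less_iff lookup_single when_def split: if_splits)

definition lead_mono :: "('v::linorder, 'k::zero) mpoly \<Rightarrow> 'v mono" where
  "lead_mono p = Max (Poly_Mapping.keys p)"

definition lead_cf :: "('v::linorder, 'k::zero) mpoly \<Rightarrow> 'k" where
  "lead_cf p = Poly_Mapping.lookup p (lead_mono p)"

definition initial_ideal ::
  "'v::linorder set \<Rightarrow> ('v, 'k::comm_ring_1) mpoly set \<Rightarrow> ('v, 'k) mpoly set" where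
  "initial_ideal V I = ideal_gen V {Poly_Mapping.single (lead_mono f) 1 | f. f \<in> I \<and> f \<noteq> 0}"

definition groebner_basis ::
  "'v::linorder set \<Rightarrow> ('v, 'k::comm_ring_1) mpoly set \<Rightarrow> ('v, 'k) mpoly set \<Rightarrow> bool" where
  "groebner_basis V I G \<longleftrightarrow>
     finite G \<and> G \<subseteq> I \<and> 0 \<notin> G \<and>
     ideal_gen V {Poly_Mapping.single (lead_mono g) 1 | g. g \<in> G} = initial_ideal V I"

definition minimal_groebner_basis ::
  "'v::linorder set \<Rightarrow> ('v, 'k::comm_ring_1) mpoly set \<Rightarrow> ('v, 'k) mpoly set \<Rightarrow> bool" where
  "minimal_groebner_basis V I G \<longleftrightarrow>
     groebner_basis V I G \<and> (\<forall>g\<in>G. lead_cf g = 1) \<and>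
     (\<forall>g\<in>G. \<forall>h\<in>G. g \<noteq> h \<longrightarrow> \<not> mono_dvd (lead_mono g) (lead_mono h))"

definition reduced_groebner_basis ::
  "'v::linorder set \<Rightarrow> ('v, 'k::comm_ring_1) mpoly set \<Rightarrow> ('v, 'k) mpoly set \<Rightarrow> bool" where
  "reduced_groebner_basis V I G \<longleftrightarrow>
     minimal_groebner_basis V I G \<and>
     (\<forall>g\<in>G. \<forall>h\<in>G. g \<noteq> h \<longrightarrow> (\<forall>m\<in>Poly_Mapping.keys h. \<not> mono_dvd (lead_mono g) m))"

lemma lead_mono_in_keys: "f \<noteq> 0 \<Longrightarrow> lead_mono f \<in> Poly_Mapping.keys f"
  unfolding lead_mono_def by (rule Max_in) auto

lemma groebner_basis_divides:
  fixes I :: "('v::linorder, 'k::comm_ring_1) mpoly set"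
  assumes G: "groebner_basis V I G" and f: "f \<in> I" "f \<noteq> 0"
  shows "\<exists>g\<in>G. mono_dvd (lead_mono g) (lead_mono f)"
proof -
  let ?t = "Poly_Mapping.single (lead_mono f) (1::'k)"
  have "?t = (\<Sum>b\<in>{?t}. 1 * b)" by simp
  moreover have "1 \<in> polys_over V" by (auto simp: polys_over_def)
  ultimately have "?t \<in> initial_ideal V I"
    unfolding initial_ideal_def ideal_gen_def using f
    by (intro CollectI exI[of _ "{?t}"] exI[of _ "\<lambda>_. 1"]) auto
  then have "?t \<in> ideal_gen V {Poly_Mapping.single (lead_mono g) 1 | g. g \<in> G}"
    using G by (simp add: groebner_basis_def)
  then obtain A q where A: "A \<subseteq> {Poly_Mapping.single (lead_mono g) 1 | g. g \<in> G}"
    and t: "?t = (\<Sum>b\<in>A. q b * b)"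
    by (auto simp: ideal_gen_def)
  have "Poly_Mapping.lookup (\<Sum>b\<in>A. q b * b) (lead_mono f) \<noteq> 0"
    unfolding t[symmetric] by simp
  then obtain b where b: "b \<in> A" "lead_mono f \<in> Poly_Mapping.keys (q b * b)"
    unfolding lookup_sum in_keys_iff by (meson sum.neutral)
  then obtain g where g: "g \<in> G" "b = Poly_Mapping.single (lead_mono g) 1" using A by auto
  obtain r where "lead_mono f = r + lead_mono g"
    using b(2) keys_mult[of "q b" b] by (auto simp: g(2) split: if_splits)
  then show ?thesis using g(1) by (auto simp: mono_dvd_def add.commute)
qed

lemma mono_dvd_antisym: "mono_dvd s t \<Longrightarrow> mono_dvd t s \<Longrightarrow> s = t"
proof -
  assume "mono_dvd s t" "mono_dvd t s"
  then obtain r r' where "t = s + r" "s = t + r'" by (auto simp: mono_dvd_def)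
  then have "\<And>v. Poly_Mapping.lookup s v = Poly_Mapping.lookup t v"
    by (metis add_leE lookup_add nle_le order_refl)
  then show "s = t" by (simp add: poly_mapping_eqI)
qed

lemma mono_dvd_trans: "mono_dvd s t \<Longrightarrow> mono_dvd t u \<Longrightarrow> mono_dvd s u"
  by (auto simp: mono_dvd_def add.assoc)

lemma mono_dvd_le:
  assumes "mono_dvd s (t :: 'v::linorder mono)"
  shows "s \<le> t"
proof -
  obtain r where r: "t = s + r" using assms by (auto simp: mono_dvd_def)
  have "\<not> r < 0" by (simp add: mono_less_iff)
  then have "s + 0 \<le> s + r" by (intro add_left_mono) simp
  then show ?thesis by (simp add: r)
qed

lemma reduced_groebner_basis_subset:
  fixes I :: "('v::linorder, 'k::comm_ring_1) mpoly set"
  assumes G: "reduced_groebner_basis V I G" and H: "reduced_groebner_basis V I H"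
    and I: "\<And>f g. f \<in> I \<Longrightarrow> g \<in> I \<Longrightarrow> f - g \<in> I"
  shows "G \<subseteq> H"
proof
  fix g assume g: "g \<in> G"
  have GB: "groebner_basis V I G" "groebner_basis V I H"
    using G H by (auto simp: reduced_groebner_basis_def minimal_groebner_basis_def)
  have GI: "\<And>f. f \<in> G \<Longrightarrow> f \<in> I \<and> f \<noteq> 0" "\<And>f. f \<in> H \<Longrightarrow> f \<in> I \<and> f \<noteq> 0"
    using GB by (auto simp: groebner_basis_def)
  obtain h where h: "h \<in> H" "mono_dvd (lead_mono h) (lead_mono g)"
    using groebner_basis_divides[OF GB(2)] GI g by blast
  obtain g' where g': "g' \<in> G" "mono_dvd (lead_mono g') (lead_mono h)"
    using groebner_basis_divides[OF GB(1)] GI h by blast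
  have "g' = g"
    using G g g'(1) mono_dvd_trans[OF g'(2) h(2)]
    by (auto simp: reduced_groebner_basis_def minimal_groebner_basis_def)
  then have lm: "lead_mono h = lead_mono g" using mono_dvd_antisym h g' by blast
  have "g - h = 0"
  proof (rule ccontr)
    assume nz: "g - h \<noteq> 0"
    let ?m = "lead_mono (g - h)"
    have mk: "?m \<in> Poly_Mapping.keys (g - h)" by (rule lead_mono_in_keys[OF nz])
    have dI: "g - h \<in> I" using I GI g h by blast
    have ne: "?m \<noteq> lead_mono g"
    proof
      assume "?m = lead_mono g"
      moreover have "Poly_Mapping.lookup g (lead_mono g) = 1" "Poly_Mapping.lookup h (lead_mono h) = 1"
        using G H g h
        by (auto simp: reduced_groebner_basis_def minimal_groebner_basis_def lead_cf_def)
      ultimately have "Poly_Mapping.lookup (g - h) ?m = 0" by (simp add: lookup_minus lm)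
      then show False using mk by (simp add: in_keys_iff)
    qed
    have "?m \<in> Poly_Mapping.keys g \<or> ?m \<in> Poly_Mapping.keys h" using mk by (auto simp: in_keys_iff lookup_minus)
    then show False
    proof
      assume m: "?m \<in> Poly_Mapping.keys g"
      obtain k where k: "k \<in> G" "mono_dvd (lead_mono k) ?m"
        using groebner_basis_divides[OF GB(1) dI nz] by blast
      then have "k = g" using G g m by (auto simp: reduced_groebner_basis_def)
      moreover have "?m \<le> lead_mono g" unfolding lead_mono_def[of g] using m by simp
      moreover have "lead_mono g \<le> ?m" using mono_dvd_le[OF k(2)] \<open>k = g\<close> by simp
      ultimately show False using ne by simp
    next
      assume m: "?m \<in> Poly_Mapping.keys h"
      obtain k where k: "k \<in> H" "mono_dvd (lead_mono k) ?m"
        using groebner_basis_divides[OF GB(2) dI nz] by blast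
      then have "k = h" using H h m by (auto simp: reduced_groebner_basis_def)
      moreover have "?m \<le> lead_mono h" unfolding lead_mono_def[of h] using m by simp
      moreover have "lead_mono h \<le> ?m" using mono_dvd_le[OF k(2)] \<open>k = h\<close> by simp
      ultimately show False using ne lm by simp
    qed
  qed
  then show "g \<in> H" using h(1) by simp
qed

lemma reduced_groebner_basis_unique:
  fixes I :: "('v::linorder, 'k::comm_ring_1) mpoly set"
  assumes "reduced_groebner_basis V I G" "reduced_groebner_basis V I H"
    and "\<And>f g. f \<in> I \<Longrightarrow> g \<in> I \<Longrightarrow> f - g \<in> I"
  shows "G = H"
  using reduced_groebner_basis_subset[OF assms]
    reduced_groebner_basis_subset[OF assms(2,1,3)] by blast

text \<open>Minimal Groebner bases have the same leading monomials but are not unique, and a minimal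
  lexicographic Groebner basis of a homogeneous ideal may even have inhomogeneous elements.
  ``The'' minimal Groebner basis of an ideal is therefore taken to be the reduced one, which is
  unique by \<open>reduced_groebner_basis_unique\<close>.\<close>

definition lex_quadratic :: "'v::linorder set \<Rightarrow> ('v, 'k::comm_ring_1) mpoly set \<Rightarrow> bool" where
  "lex_quadratic V I \<longleftrightarrow> (\<exists>G. reduced_groebner_basis V I G \<and> (\<forall>g\<in>G. quadratic g))"


section \<open>Three-dimensional Ferrers diagrams\<close>

type_synonym point = "nat \<times> nat \<times> nat"

definition ferrers_diagram :: "point set \<Rightarrow> bool" where
  "ferrers_diagram D \<longleftrightarrow>
     finite D \<and> D \<noteq> {} \<and> (\<forall>(i, j, k)\<in>D. 1 \<le> i \<and> 1 \<le> j \<and> 1 \<le> k) \<and>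
     (\<forall>(i0, j0, k0)\<in>D. \<forall>i j k. 1 \<le> i \<and> i \<le> i0 \<and> 1 \<le> j \<and> j \<le> j0 \<and> 1 \<le> k \<and> k \<le> k0
        \<longrightarrow> (i, j, k) \<in> D)"

definition a_num :: "point set \<Rightarrow> nat" where
  "a_num D = card (fst ` D)"

definition b_num :: "point set \<Rightarrow> nat \<Rightarrow> nat" where
  "b_num D i = Max {j. (i, j, 1) \<in> D}"

definition c_num :: "point set \<Rightarrow> nat \<Rightarrow> nat" where
  "c_num D i = Max {k. (i, 1, k) \<in> D}"

definition projection_property :: "point set \<Rightarrow> bool" where
  "projection_property D \<longleftrightarrow>
     (\<forall>i. 2 \<le> i \<and> i \<le> a_num D \<longrightarrow> (i - 1, b_num D i, c_num D i) \<in> D)"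

datatype xyz = X nat | Y nat | Z nat

definition xyz_mono :: "point \<Rightarrow> (xyz, 'k::comm_ring_1) mpoly" where
  "xyz_mono = (\<lambda>(i, j, k). var (X i) * var (Y j) * var (Z k))"

definition special_fiber_ideal :: "point set \<Rightarrow> (point, 'k::comm_ring_1) mpoly set" where
  "special_fiber_ideal D = {p \<in> polys_over D. eval_hom xyz_mono p = 0}"

definition minor_x :: "point set \<Rightarrow> point \<Rightarrow> point \<Rightarrow> (point, 'k::comm_ring_1) mpoly" where
  "minor_x D = (\<lambda>(i1, j1, k1) (i2, j2, k2).
     if (i2, j1, k1) \<in> D \<and> (i1, j2, k2) \<in> D
     then var (i1, j1, k1) * var (i2, j2, k2) - var (i2, j1, k1) * var (i1, j2, k2) else 0)"

definition minor_y :: "point set \<Rightarrow> point \<Rightarrow> point \<Rightarrow> (point, 'k::comm_ring_1) mpoly" where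
  "minor_y D = (\<lambda>(i1, j1, k1) (i2, j2, k2).
     if (i1, j2, k1) \<in> D \<and> (i2, j1, k2) \<in> D
     then var (i1, j1, k1) * var (i2, j2, k2) - var (i1, j2, k1) * var (i2, j1, k2) else 0)"

definition minor_z :: "point set \<Rightarrow> point \<Rightarrow> point \<Rightarrow> (point, 'k::comm_ring_1) mpoly" where
  "minor_z D = (\<lambda>(i1, j1, k1) (i2, j2, k2).
     if (i1, j1, k2) \<in> D \<and> (i2, j2, k1) \<in> D
     then var (i1, j1, k1) * var (i2, j2, k2) - var (i1, j1, k2) * var (i2, j2, k1) else 0)"

definition minors_ideal :: "point set \<Rightarrow> (point, 'k::comm_ring_1) mpoly set" where
  "minors_ideal D = ideal_gen D (\<Union>u\<in>D. \<Union>v\<in>D. {minor_x D u v, minor_y D u v, minor_z D u v})"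

text \<open>Points are ordered lexicographically by \<^theory>\<open>HOL-Library.Product_Lexorder\<close>, so that
  \<open>T\<^sub>1\<^sub>,\<^sub>1\<^sub>,\<^sub>1\<close> is the largest variable.  The coefficient ring is passed as a type argument.\<close>

definition lex_quadratic_diagram :: "'k::comm_ring_1 itself \<Rightarrow> point set \<Rightarrow> bool" where
  "lex_quadratic_diagram _ D \<longleftrightarrow> lex_quadratic D (special_fiber_ideal D :: (point, 'k) mpoly set)"

end

theory Submission
  imports Defs "HOL-Library.Multiset"
begin

text \<open>
  The substitution \<open>T\<^sub>i\<^sub>,\<^sub>j\<^sub>,\<^sub>k \<mapsto> x\<^sub>i y\<^sub>j z\<^sub>k\<close> maps monomials to monomials, so the special fiber ideal \<open>J\<close> is
  governed by its fibers: sets of monomials over the diagram with the same image.  Two observations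
  reduce the claim to a statement about these fibers.

  First, the quadratic elements of \<open>J\<close> all belong to the 2-minors ideal \<open>I\<close>, as rearranging the
  coordinates of two points amounts to a single exchange (\<open>minors_eq_binomials\<close>,
  \<open>quadratic_in_minors_ideal\<close>).  If \<open>J\<close> has a quadratic reduced Groebner basis, this basis lies in \<open>I\<close>, and
  since \<open>I\<close> is contained in \<open>J\<close>, it is also a Groebner basis of \<open>I\<close> (\<open>lex_quadratic_minors_ideal\<close>).  This
  settles the case of a lexicographically quadratic diagram.

  Second, \<open>J\<close> has a quadratic Groebner basis as soon as every monomial that is not the smallest of its
  fiber contains a product of two variables that is not the smallest of its own fiber
  (\<open>lex_quadratic_special_fiber_ideal\<close>).  For a diagram with the projection property this holds because a
  monomial without obvious lowering swaps of two variables, here called sorted, is determined by its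
  fiber (\<open>sorted_points_unique\<close>).

  The uniqueness is proved by induction on the degree; it suffices that two sorted monomials of the same
  fiber share a variable.  Consider the lowest layer \<open>x = a\<close> that occurs, and call a coordinate small if
  it also fits into the layer \<open>a + 1\<close> of the diagram.  The other coordinates are forced into the layer
  \<open>a\<close>.  By the projection property two small coordinates always fit together in the layer \<open>a\<close>, so points
  with two small coordinates must carry the largest small coordinates of the whole monomial.  Similarly,
  points with two big coordinates carry the smallest big ones.  Both kinds cannot occur together, and
  their numbers follow from counting; so if either occurs, it can be reconstructed from the fiber.
  Otherwise each point of the layer has one big coordinate, and the smallest big \<open>z\<close> (or \<open>y\<close>) is joined
  with the largest small partner that the diagram admits.
\<close>

section \<open>Sorted multisets of points of a Ferrers diagram\<close>

abbreviation xc :: "point \<Rightarrow> nat" where "xc u \<equiv> fst u"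
abbreviation yc :: "point \<Rightarrow> nat" where "yc u \<equiv> fst (snd u)"
abbreviation zc :: "point \<Rightarrow> nat" where "zc u \<equiv> snd (snd u)"

text \<open>Two monomials lie over the same monomial in the \<open>x\<^sub>i\<close>, \<open>y\<^sub>j\<close>, \<open>z\<^sub>k\<close> exactly when the multisets of their
  variables agree in each coordinate separately.\<close>

definition same_marginals :: "point multiset \<Rightarrow> point multiset \<Rightarrow> bool" where
  "same_marginals M N \<longleftrightarrow>
     image_mset xc M = image_mset xc N \<and> image_mset yc M = image_mset yc N \<and>
     image_mset zc M = image_mset zc N"

text \<open>These are the monomials without an obvious lowering swap of two variables.  In a common
  \<open>x\<close>-layer, \<open>(j, k)\<close> and \<open>(j', k')\<close> with \<open>j < j'\<close> and \<open>k < k'\<close> can exchange their last coordinates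
  inside the diagram.  In different layers, the lexicographically smallest product puts both maxima
  into the lower layer; if that point belongs to the diagram, it has to be occupied already.  When it
  does not belong to the diagram, a sorted multiset may mix the coordinates in either way: under the
  projection property the swap that would still lower such a pair is never inside the diagram.\<close>

definition sorted_points :: "point set \<Rightarrow> point multiset \<Rightarrow> bool" where
  "sorted_points D M \<longleftrightarrow> (\<forall>u\<in>#M. \<forall>v\<in>#M.
     (xc u = xc v \<longrightarrow> \<not> (yc u < yc v \<and> zc u < zc v)) \<and>
     (xc u < xc v \<longrightarrow> (xc u, max (yc u) (yc v), max (zc u) (zc v)) \<in> D \<longrightarrow>
        yc v \<le> yc u \<and> zc v \<le> zc u))"

lemma ferrers_diagram_down:
  assumes "ferrers_diagram D" "(i0, j0, k0) \<in> D"
    and "1 \<le> i" "i \<le> i0" "1 \<le> j" "j \<le> j0" "1 \<le> k" "k \<le> k0"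
  shows "(i, j, k) \<in> D"
  using assms unfolding ferrers_diagram_def by blast

lemma ferrers_diagram_pos:
  assumes "ferrers_diagram D" "(i, j, k) \<in> D"
  shows "1 \<le> i" "1 \<le> j" "1 \<le> k"
  using assms unfolding ferrers_diagram_def by blast+

text \<open>The layer \<open>a\<close> contains the bounding rectangle of the layer above it.  Phrased by membership, this
  avoids the maxima, which are meaningless for an empty layer.\<close>

lemma projection_propertyD:
  assumes D: "ferrers_diagram D" and P: "projection_property D"
    and a: "1 \<le> a" and j: "(Suc a, j, 1) \<in> D" and k: "(Suc a, 1, k) \<in> D"
  shows "(a, j, k) \<in> D"
proof -
  have fin: "finite D" using D by (simp add: ferrers_diagram_def)
  have "{1..Suc a} \<subseteq> fst ` D"
  proof
    fix i assume "i \<in> {1..Suc a}"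
    then have "(i, 1, 1) \<in> D"
      using ferrers_diagram_down[OF D k, of i 1 1] ferrers_diagram_pos[OF D k] by auto
    then show "i \<in> fst ` D" by force
  qed
  then have "card {1..Suc a} \<le> a_num D" unfolding a_num_def using fin by (intro card_mono) auto
  then have "(a, b_num D (Suc a), c_num D (Suc a)) \<in> D"
    using P[unfolded projection_property_def, rule_format, of "Suc a"] a by simp
  moreover have "finite {j. (Suc a, j, 1) \<in> D}"
    by (rule finite_subset[of _ "yc ` D"]) (use fin in \<open>force+\<close>)
  then have "j \<le> b_num D (Suc a)" unfolding b_num_def using j by (intro Max_ge) auto
  moreover have "finite {k. (Suc a, 1, k) \<in> D}"
    by (rule finite_subset[of _ "zc ` D"]) (use fin in \<open>force+\<close>)
  then have "k \<le> c_num D (Suc a)" unfolding c_num_def using k by (intro Max_ge) auto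
  ultimately show ?thesis
    using ferrers_diagram_down[OF D] a ferrers_diagram_pos[OF D j] ferrers_diagram_pos[OF D k]
    by blast
qed

text \<open>A part of fixed size whose elements all precede those of its complement is determined by the whole:
  if two such parts differed, each would contain an element of the complement of the other, and these
  two elements would precede each other.\<close>

lemma extreme_part_unique:
  assumes sum: "A + R = A' + R'" and size: "size A = size A'"
    and R: "\<And>x y. x \<in># A \<Longrightarrow> y \<in># R \<Longrightarrow> P x y" and R': "\<And>x y. x \<in># A' \<Longrightarrow> y \<in># R' \<Longrightarrow> P x y"
    and P: "\<And>x y. P x y \<Longrightarrow> P y x \<Longrightarrow> x = y"
  shows "A = A'"
proof (rule ccontr)
  assume ne: "A \<noteq> A'"
  have count: "count A x + count R x = count A' x + count R' x" for x
    using sum by (metis count_union)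
  have "\<not> A \<subseteq># A'" "\<not> A' \<subseteq># A"
    using ne size by (metis mset_subset_size nless_le subset_mset.less_le)+
  then obtain x x' where x: "count A' x < count A x" and x': "count A x' < count A' x'"
    by (auto simp: subseteq_mset_def not_le)
  have "x \<in># A" "x \<in># R'" "x' \<in># A'" "x' \<in># R"
    using x x' count[of x] count[of x'] by (simp_all add: count_greater_zero_iff[symmetric] del: count_greater_zero_iff)
  then have "x = x'" using P R R' by blast
  then show False using x x' by simp
qed

text \<open>How \<open>extreme_part_unique\<close> enters below: \<open>s\<close> cuts a part out of a marginal, which is known, and \<open>K\<close> is a
  class of points whose coordinates are extreme in that part.\<close>

lemma extreme_class_coordinates:
  assumes eq: "image_mset f M = image_mset f N"
    and s: "\<And>u. K u \<Longrightarrow> s (f u)"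
    and size: "size (filter_mset K M) = size (filter_mset K N)"
    and M: "\<And>u v. u \<in># M \<Longrightarrow> v \<in># M \<Longrightarrow> K u \<Longrightarrow> \<not> K v \<Longrightarrow> s (f v) \<Longrightarrow> P (f u) (f v)"
    and N: "\<And>u v. u \<in># N \<Longrightarrow> v \<in># N \<Longrightarrow> K u \<Longrightarrow> \<not> K v \<Longrightarrow> s (f v) \<Longrightarrow> P (f u) (f v)"
    and P: "\<And>x y. P x y \<Longrightarrow> P y x \<Longrightarrow> x = y"
  shows "image_mset f (filter_mset K M) = image_mset f (filter_mset K N)"
proof -
  have split: "filter_mset s (image_mset f L) =
      image_mset f (filter_mset K L) + image_mset f (filter_mset (\<lambda>u. \<not> K u \<and> s (f u)) L)" for L
    by (induction L) (auto simp: s)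
  show ?thesis
    by (rule extreme_part_unique[where P = P, OF split[of M, unfolded eq split[of N], symmetric]])
      (use size M N P in auto)
qed

text \<open>In a weakly decreasing chain, the point with the largest \<open>y\<close> and the point with the smallest \<open>z\<close> can be
  taken to be the same.  It can therefore be read off from the two marginals of the chain.\<close>

lemma antichain_corner:
  assumes ne: "S \<noteq> {#}"
    and chain: "\<And>u v. u \<in># S \<Longrightarrow> v \<in># S \<Longrightarrow> \<not> (yc u < yc v \<and> zc u < zc v)"
    and a: "\<And>u. u \<in># S \<Longrightarrow> xc u = a"
  shows "(a, Max_mset (image_mset yc S), Min_mset (image_mset zc S)) \<in># S"
proof -
  let ?p = "Max_mset (image_mset yc S)" and ?q = "Min_mset (image_mset zc S)"
  have "?p \<in> yc ` set_mset S" "?q \<in> zc ` set_mset S"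
    using ne Max_in[of "yc ` set_mset S"] Min_in[of "zc ` set_mset S"] by auto
  then obtain u v where u: "u \<in># S" "yc u = ?p" and v: "v \<in># S" "zc v = ?q" by fastforce
  have "yc v \<le> ?p" "?q \<le> zc u" using u(1) v(1) by simp_all
  then have "zc u = ?q \<or> yc v = ?p" using chain[OF v(1) u(1)] u v by linarith
  then show ?thesis
  proof
    assume "zc u = ?q"
    then have "u = (a, ?p, ?q)" using u a by (metis prod.collapse)
    then show ?thesis using u(1) by simp
  next
    assume "yc v = ?p"
    then have "v = (a, ?p, ?q)" using v a by (metis prod.collapse)
    then show ?thesis using v(1) by simp
  qed
qed

text \<open>If only points with \<open>g = k\<close> could compete for the largest admissible value of \<open>f\<close>, then one of them has
  it; this locates a point of \<open>M\<close> by means of the marginals alone.\<close>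

lemma strip_corner:
  fixes f g :: "'a \<Rightarrow> nat"
  assumes w: "w \<in># M" "g w = k"
    and allowed: "\<And>u. u \<in># M \<Longrightarrow> g u = k \<Longrightarrow> Q (f u)"
    and sorted: "\<And>u v. u \<in># M \<Longrightarrow> v \<in># M \<Longrightarrow> g u = k \<Longrightarrow> Q (f v) \<Longrightarrow> g v \<noteq> k \<Longrightarrow> f v \<le> f u"
  shows "\<exists>u\<in>#M. g u = k \<and> f u = Max_mset (filter_mset Q (image_mset f M))"
proof -
  let ?S = "set_mset (filter_mset Q (image_mset f M))"
  have wS: "f w \<in> ?S" using w allowed[OF w] by auto
  then have "Max ?S \<in> ?S" by (intro Max_in) auto
  then obtain v where v: "v \<in># M" "f v = Max ?S" "Q (f v)" by auto
  show ?thesis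
  proof (cases "g v = k")
    case True
    then show ?thesis using v by auto
  next
    case False
    have "f v \<le> f w" using sorted[OF w(1) v(1) w(2) v(3) False] .
    moreover have "f w \<le> Max ?S" using wS by (intro Max_ge) auto
    ultimately show ?thesis using w v by (metis order_antisym)
  qed
qed

section \<open>The lowest layer of a sorted multiset\<close>

lemma class_sizes:
  assumes "\<forall>u\<in>#M. \<not> L u \<longrightarrow> s u \<and> t u"
  shows "size {#u \<in># M. L u \<and> s u \<and> t u#} + size {#u \<in># M. \<not> s u#} + size {#u \<in># M. \<not> t u#} =
    size {#u \<in># M. L u#} + size {#u \<in># M. \<not> s u \<and> \<not> t u#}"
  using assms by (induction M) auto

text \<open>The lowest \<open>x\<close>-layer \<open>a\<close> of a sorted multiset.  A \<open>y\<close>- or \<open>z\<close>-coordinate is small if it occurs in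
  the layer \<open>a + 1\<close> of the diagram; coordinates that are not small can only be used in the layer \<open>a\<close>.
  In the top layer nothing is small.\<close>

locale lowest_layer =
  fixes D :: "point set" and a :: nat and M :: "point multiset"
  assumes ferrers: "ferrers_diagram D" and proj: "projection_property D"
    and M_D: "set_mset M \<subseteq> D" and M_sorted: "sorted_points D M"
    and a_le: "\<And>u. u \<in># M \<Longrightarrow> a \<le> xc u" and a_pos: "1 \<le> a"
begin

definition ysm :: "nat \<Rightarrow> bool" where "ysm j \<longleftrightarrow> (Suc a, j, 1) \<in> D"
definition zsm :: "nat \<Rightarrow> bool" where "zsm k \<longleftrightarrow> (Suc a, 1, k) \<in> D"

abbreviation SS :: "point \<Rightarrow> bool" where "SS u \<equiv> xc u = a \<and> ysm (yc u) \<and> zsm (zc u)"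
abbreviation BB :: "point \<Rightarrow> bool" where "BB u \<equiv> \<not> ysm (yc u) \<and> \<not> zsm (zc u)"

lemma small_small: "ysm j \<Longrightarrow> zsm k \<Longrightarrow> (a, j, k) \<in> D"
  unfolding ysm_def zsm_def by (rule projection_propertyD[OF ferrers proj a_pos])

lemma in_D: "u \<in># M \<Longrightarrow> (xc u, yc u, zc u) \<in> D"
  using M_D by auto

lemma upper_small:
  assumes "u \<in># M" "xc u \<noteq> a"
  shows "ysm (yc u)" "zsm (zc u)"
proof -
  have "Suc a \<le> xc u" using assms(2) a_le[OF assms(1)] by simp
  note down = ferrers_diagram_down[OF ferrers in_D[OF assms(1)] _ this]
  show "ysm (yc u)" "zsm (zc u)"
    unfolding ysm_def zsm_def
    using down[of "yc u" 1] down[of 1 "zc u"] ferrers_diagram_pos[OF ferrers in_D[OF assms(1)]]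
    by simp_all
qed

lemma ysm_less:
  assumes "v \<in># M" "ysm (yc u)" "\<not> ysm (yc v)"
  shows "yc u < yc v"
proof (rule ccontr)
  assume "\<not> yc u < yc v"
  then have "(Suc a, yc v, 1) \<in> D"
    using ferrers_diagram_down[OF ferrers assms(2)[unfolded ysm_def]]
      ferrers_diagram_pos(2)[OF ferrers in_D[OF assms(1)]] by simp
  then show False using assms(3) by (simp add: ysm_def)
qed

lemma zsm_less:
  assumes "v \<in># M" "zsm (zc u)" "\<not> zsm (zc v)"
  shows "zc u < zc v"
proof (rule ccontr)
  assume "\<not> zc u < zc v"
  then have "(Suc a, 1, zc v) \<in> D"
    using ferrers_diagram_down[OF ferrers assms(2)[unfolded zsm_def]]
      ferrers_diagram_pos(3)[OF ferrers in_D[OF assms(1)]] by simp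
  then show False using assms(3) by (simp add: zsm_def)
qed

lemma layer_chain:
  assumes "u \<in># M" "v \<in># M" "xc u = xc v" "yc u < yc v"
  shows "zc v \<le> zc u"
  using M_sorted[unfolded sorted_points_def, rule_format, OF assms(1,2)] assms(3,4) by linarith

lemma layer_above:
  assumes "u \<in># M" "v \<in># M" "xc u = a" "xc v \<noteq> a"
    and "(a, max (yc u) (yc v), max (zc u) (zc v)) \<in> D"
  shows "yc v \<le> yc u \<and> zc v \<le> zc u"
proof -
  have "xc u < xc v" using a_le[OF assms(2)] assms(3,4) by linarith
  then show ?thesis
    using M_sorted[unfolded sorted_points_def] assms by blast
qed

text \<open>A point with two small coordinates lies strictly below a point with two big ones, and no layer of a
  sorted multiset has room for both.\<close>

lemma SS_excludes_BB:
  assumes "u \<in># M" "SS u" "v \<in># M" "BB v"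
  shows False
proof -
  have "xc v = a" using upper_small(1)[OF assms(3)] assms(4) by blast
  moreover have "yc u < yc v" "zc u < zc v"
    using ysm_less[OF assms(3)] zsm_less[OF assms(3)] assms(2,4) by blast+
  ultimately show False using layer_chain[OF assms(1,3)] assms(2) by linarith
qed

text \<open>Counting the layer \<open>a\<close>, the big \<open>y\<close>'s and the big \<open>z\<close>'s, which are all marginal data, determines the
  difference between the numbers of \<open>SS\<close>- and \<open>BB\<close>-points.\<close>

lemma size_SS_BB:
  "size (filter_mset SS M) + size (filter_mset (Not \<circ> ysm) (image_mset yc M))
      + size (filter_mset (Not \<circ> zsm) (image_mset zc M)) =
    count (image_mset xc M) a + size (filter_mset BB M)"
proof -
  have "count (image_mset xc M) a = size {#u \<in># M. xc u = a#}"
    by (induction M) auto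
  then show ?thesis
    using class_sizes[of M "\<lambda>u. xc u = a" "\<lambda>u. ysm (yc u)" "\<lambda>u. zsm (zc u)"] upper_small
    by (simp add: filter_mset_image_mset comp_def)
qed

text \<open>Small coordinates are all compatible in the layer \<open>a\<close>: this is where the projection property enters.
  Hence an \<open>SS\<close>-point dominates every point of a higher layer; within the layer \<open>a\<close> the chain condition
  places it beyond the points with one small coordinate.\<close>

lemma SS_top:
  assumes "u \<in># M" "v \<in># M" "SS u" "\<not> SS v"
  shows "ysm (yc v) \<Longrightarrow> yc v \<le> yc u" "zsm (zc v) \<Longrightarrow> zc v \<le> zc u"
proof -
  have top: "yc v \<le> yc u \<and> zc v \<le> zc u" if "xc v \<noteq> a"
  proof (rule layer_above)
    have "ysm (max (yc u) (yc v))" "zsm (max (zc u) (zc v))"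
      using upper_small[OF assms(2) that] assms(3) by (auto simp: max_def)
    then show "(a, max (yc u) (yc v), max (zc u) (zc v)) \<in> D" by (rule small_small)
  qed (use assms that in auto)
  show "yc v \<le> yc u" if "ysm (yc v)"
  proof (cases "xc v = a")
    case True
    then have "zc u < zc v" using zsm_less[OF assms(2)] assms(3,4) that by blast
    then show ?thesis using layer_chain[OF assms(1,2)] assms(3) True by linarith
  qed (use top in blast)
  show "zc v \<le> zc u" if "zsm (zc v)"
  proof (cases "xc v = a")
    case True
    then have "yc u < yc v" using ysm_less[OF assms(2)] assms(3,4) that by blast
    then show ?thesis using layer_chain[OF assms(1,2)] assms(3) True by linarith
  qed (use top in blast)
qed

text \<open>Dually, the \<open>BB\<close>-points carry the smallest of the big coordinates.\<close>

lemma BB_bottom: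
  assumes "u \<in># M" "v \<in># M" "BB u" "\<not> BB v"
  shows "\<not> ysm (yc v) \<Longrightarrow> yc u \<le> yc v" "\<not> zsm (zc v) \<Longrightarrow> zc u \<le> zc v"
proof -
  have xu: "xc u = a" using upper_small assms by blast
  show "yc u \<le> yc v" if "\<not> ysm (yc v)"
  proof -
    have "xc v = a" using upper_small(1)[OF assms(2)] that by blast
    moreover have "zc v < zc u" using zsm_less[OF assms(1)] assms(3,4) that by blast
    ultimately show ?thesis using layer_chain[OF assms(2,1)] xu by linarith
  qed
  show "zc u \<le> zc v" if "\<not> zsm (zc v)"
  proof -
    have "xc v = a" using upper_small(2)[OF assms(2)] that by blast
    moreover have "yc v < yc u" using ysm_less[OF assms(1)] assms(3,4) that by blast
    ultimately show ?thesis using layer_chain[OF assms(2,1)] xu by linarith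
  qed
qed

lemma layer_class_corner:
  assumes "filter_mset K M \<noteq> {#}" and K: "\<And>u. u \<in># M \<Longrightarrow> K u \<Longrightarrow> xc u = a"
  shows "(a, Max_mset (image_mset yc (filter_mset K M)), Min_mset (image_mset zc (filter_mset K M))) \<in># M"
proof -
  have "\<not> (yc u < yc v \<and> zc u < zc v)" if "u \<in># filter_mset K M" "v \<in># filter_mset K M" for u v
    using layer_chain[of u v] K[of u] K[of v] that by auto
  then have "(a, Max_mset (image_mset yc (filter_mset K M)), Min_mset (image_mset zc (filter_mset K M)))
      \<in># filter_mset K M"
    by (rule antichain_corner[OF assms(1)]) (use K in auto)
  then show ?thesis by simp
qed

lemma SS_corner:
  assumes "filter_mset SS M \<noteq> {#}"
  shows "(a, Max_mset (image_mset yc (filter_mset SS M)), Min_mset (image_mset zc (filter_mset SS M))) \<in># M"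
  by (rule layer_class_corner[OF assms]) simp

lemma BB_corner:
  assumes "filter_mset BB M \<noteq> {#}"
  shows "(a, Max_mset (image_mset yc (filter_mset BB M)), Min_mset (image_mset zc (filter_mset BB M))) \<in># M"
  by (rule layer_class_corner[OF assms]) (use upper_small in blast)

text \<open>If every point of the layer has exactly one small coordinate, the smallest big \<open>z\<close> is paired with the
  largest small \<open>y\<close> that the diagram allows next to it.  A point with a larger such \<open>y\<close> would have to
  carry a bigger \<open>z\<close> in the layer \<open>a\<close>, against the chain condition, or lie in a higher layer, against
  the sorting condition.\<close>

lemma z_strip_corner:
  assumes no: "filter_mset SS M = {#}" "filter_mset BB M = {#}"
    and ne: "filter_mset (Not \<circ> zsm) (image_mset zc M) \<noteq> {#}"
  defines "k \<equiv> Min_mset (filter_mset (Not \<circ> zsm) (image_mset zc M))"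
  shows "(a, Max_mset (filter_mset (\<lambda>j. ysm j \<and> (a, j, k) \<in> D) (image_mset yc M)), k) \<in># M"
proof -
  have "k \<in># filter_mset (Not \<circ> zsm) (image_mset zc M)" unfolding k_def using ne by (intro Min_in) auto
  then obtain w where w: "w \<in># M" "zc w = k" and big: "\<not> zsm k" by auto
  have k_le: "k \<le> zc v" if "v \<in># M" "\<not> zsm (zc v)" for v
    unfolding k_def using that by (intro Min_le) auto
  have noSS: "\<not> SS u" and noBB: "\<not> BB u" if "u \<in># M" for u
    using no[unfolded filter_mset_eq_mempty_iff] that by blast+
  have xa: "xc u = a" if "u \<in># M" "zc u = k" for u
    using upper_small[OF that(1)] big that by blast
  have allowed: "ysm (yc u) \<and> (a, yc u, k) \<in> D" if "u \<in># M" "zc u = k" for u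
    using noBB[OF that(1)] big xa[OF that] that in_D by metis
  have "\<exists>u\<in>#M. zc u = k \<and> yc u =
      Max_mset (filter_mset (\<lambda>j. ysm j \<and> (a, j, k) \<in> D) (image_mset yc M))"
  proof (rule strip_corner[where f = yc and g = zc and Q = "\<lambda>j. ysm j \<and> (a, j, k) \<in> D", OF w allowed])
    fix u v assume u: "u \<in># M" "zc u = k" and v: "v \<in># M" "zc v \<noteq> k"
      and Q: "ysm (yc v) \<and> (a, yc v, k) \<in> D"
    show "yc v \<le> yc u"
    proof (cases "xc v = a")
      case True
      then have "\<not> zsm (zc v)" using noSS[OF v(1)] Q by blast
      then have "k < zc v" using k_le[OF v(1)] v(2) by linarith
      then show ?thesis
        using layer_chain[OF u(1) v(1)] xa[OF u] True u(2) by linarith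
    next
      case False
      have less: "zc v < zc u" using zsm_less[OF u(1)] upper_small[OF v(1) False] big u(2) by blast
      show ?thesis
      proof (rule ccontr)
        assume "\<not> ?thesis"
        then show False
          using less layer_above[OF u(1) v(1) xa[OF u] False] Q u(2) by (simp add: max_def)
      qed
    qed
  qed
  then show ?thesis using xa by (metis prod.collapse)
qed

text \<open>The mirror image, for layers in which all big coordinates are \<open>y\<close>'s.\<close>

lemma y_strip_corner:
  assumes no: "filter_mset SS M = {#}" "filter_mset BB M = {#}"
    and ne: "filter_mset (Not \<circ> ysm) (image_mset yc M) \<noteq> {#}"
  defines "j \<equiv> Min_mset (filter_mset (Not \<circ> ysm) (image_mset yc M))"
  shows "(a, j, Max_mset (filter_mset (\<lambda>k. zsm k \<and> (a, j, k) \<in> D) (image_mset zc M))) \<in># M"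
proof -
  have "j \<in># filter_mset (Not \<circ> ysm) (image_mset yc M)" unfolding j_def using ne by (intro Min_in) auto
  then obtain w where w: "w \<in># M" "yc w = j" and big: "\<not> ysm j" by auto
  have j_le: "j \<le> yc v" if "v \<in># M" "\<not> ysm (yc v)" for v
    unfolding j_def using that by (intro Min_le) auto
  have noSS: "\<not> SS u" and noBB: "\<not> BB u" if "u \<in># M" for u
    using no[unfolded filter_mset_eq_mempty_iff] that by blast+
  have xa: "xc u = a" if "u \<in># M" "yc u = j" for u
    using upper_small[OF that(1)] big that by blast
  have allowed: "zsm (zc u) \<and> (a, j, zc u) \<in> D" if "u \<in># M" "yc u = j" for u
    using noBB[OF that(1)] big xa[OF that] that in_D by metis
  have "\<exists>u\<in>#M. yc u = j \<and> zc u =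
      Max_mset (filter_mset (\<lambda>k. zsm k \<and> (a, j, k) \<in> D) (image_mset zc M))"
  proof (rule strip_corner[where f = zc and g = yc and Q = "\<lambda>k. zsm k \<and> (a, j, k) \<in> D", OF w allowed])
    fix u v assume u: "u \<in># M" "yc u = j" and v: "v \<in># M" "yc v \<noteq> j"
      and Q: "zsm (zc v) \<and> (a, j, zc v) \<in> D"
    show "zc v \<le> zc u"
    proof (cases "xc v = a")
      case True
      then have "\<not> ysm (yc v)" using noSS[OF v(1)] Q by blast
      then have "j < yc v" using j_le[OF v(1)] v(2) by linarith
      then show ?thesis
        using layer_chain[OF u(1) v(1)] xa[OF u] True u(2) by linarith
    next
      case False
      have less: "yc v < yc u" using ysm_less[OF u(1)] upper_small[OF v(1) False] big u(2) by blast
      show ?thesis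
      proof (rule ccontr)
        assume "\<not> ?thesis"
        then show False
          using less layer_above[OF u(1) v(1) xa[OF u] False] Q u(2) by (simp add: max_def)
      qed
    qed
  qed
  then show ?thesis using xa by (metis prod.collapse)
qed

end

section \<open>Sorted multisets are determined by their marginals\<close>

text \<open>The shape of the lowest layer is dictated by the marginals: they decide whether it has \<open>SS\<close>-points,
  \<open>BB\<close>-points, or neither.  In each case they also determine one concrete point that both multisets must
  contain, namely a corner of the respective class.\<close>

lemma sorted_points_common_point:
  assumes D: "ferrers_diagram D" "projection_property D"
    and M: "set_mset M \<subseteq> D" "sorted_points D M" and N: "set_mset N \<subseteq> D" "sorted_points D N"
    and eq: "same_marginals M N" and ne: "M \<noteq> {#}"
  shows "\<exists>u. u \<in># M \<and> u \<in># N"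
proof -
  define a where "a = Min_mset (image_mset xc M)"
  have eqs: "image_mset xc M = image_mset xc N" "image_mset yc M = image_mset yc N"
    "image_mset zc M = image_mset zc N"
    using eq by (auto simp: same_marginals_def)
  have aM: "a \<in># image_mset xc M" unfolding a_def using ne by (intro Min_in) auto
  then obtain u where "u \<in># M" "xc u = a" by auto
  then have pos: "1 \<le> a"
    using M(1) ferrers_diagram_pos(1)[OF D(1), of "xc u" "yc u" "zc u"] by auto
  have a_le: "a \<le> i" if "i \<in># image_mset xc M" for i
    unfolding a_def using that by (intro Min_le) auto
  interpret M: lowest_layer D a M
  proof
    show "a \<le> xc u" if "u \<in># M" for u using a_le[of "xc u"] that by simp
  qed (fact D M pos)+
  interpret N: lowest_layer D a N
  proof
    show "a \<le> xc u" if "u \<in># N" for u using a_le[of "xc u"] that unfolding eqs(1) by simp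
  qed (fact D N pos)+
  note sizes = M.size_SS_BB N.size_SS_BB[folded eqs]
  have M_excl: "size (filter_mset M.SS M) = 0 \<or> size (filter_mset M.BB M) = 0"
    unfolding size_eq_0_iff_empty filter_mset_eq_mempty_iff using M.SS_excludes_BB by blast
  have N_excl: "size (filter_mset M.SS N) = 0 \<or> size (filter_mset M.BB N) = 0"
    unfolding size_eq_0_iff_empty filter_mset_eq_mempty_iff using N.SS_excludes_BB by blast
  \<comment> \<open>Both equations of \<open>sizes\<close> have the same marginal terms, and one of the two classes is empty on either side.\<close>
  have sizeSS: "size (filter_mset M.SS M) = size (filter_mset M.SS N)"
    using sizes M_excl N_excl by linarith
  have sizeBB: "size (filter_mset M.BB M) = size (filter_mset M.BB N)"
    using sizes sizeSS by linarith
  have common: ?thesis if "u \<in># M" "u \<in># N" for u using that by blast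
  consider "filter_mset M.SS M \<noteq> {#}" | "filter_mset M.BB M \<noteq> {#}"
    | "filter_mset M.SS M = {#}" "filter_mset M.BB M = {#}" by blast
  then show ?thesis
  proof cases
    case 1
    have y: "image_mset yc (filter_mset M.SS M) = image_mset yc (filter_mset M.SS N)"
      by (rule extreme_class_coordinates[where s = M.ysm and P = "(\<ge>)"
            and K = M.SS, OF eqs(2) _ sizeSS M.SS_top(1) N.SS_top(1)])
        simp_all
    have z: "image_mset zc (filter_mset M.SS M) = image_mset zc (filter_mset M.SS N)"
      by (rule extreme_class_coordinates[where s = M.zsm and P = "(\<ge>)"
            and K = M.SS, OF eqs(3) _ sizeSS M.SS_top(2) N.SS_top(2)])
        simp_all
    have "filter_mset M.SS N \<noteq> {#}" using 1 sizeSS unfolding nonempty_has_size by linarith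
    from M.SS_corner[OF 1] N.SS_corner[OF this] show ?thesis unfolding y z by (rule common)
  next
    case 2
    have y: "image_mset yc (filter_mset M.BB M) = image_mset yc (filter_mset M.BB N)"
      by (rule extreme_class_coordinates[where s = "\<lambda>i. \<not> M.ysm i" and P = "(\<le>)"
            and K = M.BB, OF eqs(2) _ sizeBB M.BB_bottom(1) N.BB_bottom(1)])
        simp_all
    have z: "image_mset zc (filter_mset M.BB M) = image_mset zc (filter_mset M.BB N)"
      by (rule extreme_class_coordinates[where s = "\<lambda>i. \<not> M.zsm i" and P = "(\<le>)"
            and K = M.BB, OF eqs(3) _ sizeBB M.BB_bottom(2) N.BB_bottom(2)])
        simp_all
    have "filter_mset M.BB N \<noteq> {#}" using 2 sizeBB unfolding nonempty_has_size by linarith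
    from M.BB_corner[OF 2] N.BB_corner[OF this] show ?thesis unfolding y z by (rule common)
  next
    case 3
    have N3: "filter_mset M.SS N = {#}" "filter_mset M.BB N = {#}"
      by (rule size_eq_0_iff_empty[THEN iffD1], use sizeSS sizeBB in \<open>simp only: 3 size_empty\<close>)+
    have "0 < count (image_mset xc M) a" using aM by simp
    then have "0 < size (filter_mset (Not \<circ> M.ysm) (image_mset yc M)) \<or>
        0 < size (filter_mset (Not \<circ> M.zsm) (image_mset zc M))"
      using sizes(1) unfolding 3 by linarith
    then show ?thesis
    proof
      assume "0 < size (filter_mset (Not \<circ> M.ysm) (image_mset yc M))"
      then have ne: "filter_mset (Not \<circ> M.ysm) (image_mset yc M) \<noteq> {#}" by (simp only: nonempty_has_size)
      from M.y_strip_corner[OF 3 ne] N.y_strip_corner[OF N3 ne[unfolded eqs]]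
      show ?thesis unfolding eqs by (rule common)
    next
      assume "0 < size (filter_mset (Not \<circ> M.zsm) (image_mset zc M))"
      then have ne: "filter_mset (Not \<circ> M.zsm) (image_mset zc M) \<noteq> {#}" by (simp only: nonempty_has_size)
      from M.z_strip_corner[OF 3 ne] N.z_strip_corner[OF N3 ne[unfolded eqs]]
      show ?thesis unfolding eqs by (rule common)
    qed
  qed
qed

text \<open>Removing a common point keeps both multisets sorted with equal marginals.\<close>

lemma sorted_points_unique:
  assumes D: "ferrers_diagram D" "projection_property D"
    and "set_mset M \<subseteq> D" "sorted_points D M" "set_mset N \<subseteq> D" "sorted_points D N"
    and "same_marginals M N"
  shows "M = N"
  using assms(3-)
proof (induction M arbitrary: N rule: measure_induct_rule[of size])
  case (less M)
  show ?case
  proof (cases "M = {#}")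
    case True
    then show ?thesis using less.prems(5) by (simp add: same_marginals_def)
  next
    case False
    obtain u where u: "u \<in># M" "u \<in># N"
      using sorted_points_common_point[OF D less.prems False] by blast
    have "M - {#u#} = N - {#u#}"
    proof (rule less.IH)
      show "size (M - {#u#}) < size M" using u by (simp add: size_Diff1_less)
      show "sorted_points D (M - {#u#})" "sorted_points D (N - {#u#})"
        using less.prems(2,4) by (auto simp: sorted_points_def dest!: in_diffD)
      show "same_marginals (M - {#u#}) (N - {#u#})"
        using less.prems(5) u by (simp add: same_marginals_def image_mset_Diff)
    qed (use less.prems in \<open>auto dest: in_diffD\<close>)
    then show ?thesis using u by (metis insert_DiffM)
  qed
qed

section \<open>Monomials as multisets\<close>

text \<open>Multisets of variables are easier to split and to pair up than exponent vectors; \<open>mon\<close> is an additive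
  bijection between the two.\<close>

definition mon :: "'v multiset \<Rightarrow> 'v mono" where
  "mon M = (\<Sum>v\<in>#M. Poly_Mapping.single v 1)"

lemma lookup_mon: "Poly_Mapping.lookup (mon M) v = count M v"
  by (induction M) (auto simp: mon_def lookup_add lookup_single when_def)

lemma mon_union: "mon (M + N) = mon M + mon N"
  by (simp add: mon_def)

lemma keys_mon: "Poly_Mapping.keys (mon M) = set_mset M"
  by (auto simp: in_keys_iff lookup_mon)

lemma inj_mon: "inj mon"
  by (metis injI lookup_mon multiset_eqI)

lemma mon_inject: "mon M = mon N \<longleftrightarrow> M = N"
  using inj_mon by (auto dest: injD)

lemma mon_surj: obtains M where "m = mon M"
proof
  show "m = mon (\<Sum>v\<in>Poly_Mapping.keys m. replicate_mset (Poly_Mapping.lookup m v) v)"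
    by (rule poly_mapping_eqI) (auto simp: lookup_mon count_sum in_keys_iff)
qed

lemma mono_degree_mon: "mono_degree (mon M) = size M"
  by (simp add: mono_degree_def keys_mon lookup_mon size_multiset_overloaded_eq)

lemma mon_dvd_same_size:
  assumes "mono_dvd (mon S) (mon T)" "size S = size T"
  shows "S = T"
proof -
  obtain r where r: "mon T = mon S + r" using assms(1) by (auto simp: mono_dvd_def)
  obtain R where "r = mon R" by (rule mon_surj)
  then have "T = S + R" using r by (simp add: mon_union[symmetric] mon_inject)
  then show ?thesis using assms(2) by simp
qed

text \<open>The lexicographic order first compares the exponents of the largest variable involved, which is the
  smallest point.\<close>

lemma mon_less_leading_point:
  fixes S T :: "'v::linorder multiset"
  assumes "u \<in># T" and "\<And>w. w \<in># S \<Longrightarrow> u < w" and "\<And>w. w \<in># T \<Longrightarrow> u \<le> w"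
  shows "mon S < mon T"
  unfolding mono_less_iff lookup_mon
proof (intro exI conjI allI impI)
  show "count S u < count T u"
    using assms(1,2) by (metis count_greater_zero_iff less_irrefl not_in_iff)
  show "count S w = count T w" if "w < u" for w
    using assms(2)[of w] assms(3)[of w] that by (metis leD less_asym not_in_iff)
qed

section \<open>The toric parametrization\<close>

definition xyz_exponent :: "point \<Rightarrow> xyz mono" where
  "xyz_exponent u = Poly_Mapping.single (X (xc u)) 1 + Poly_Mapping.single (Y (yc u)) 1
     + Poly_Mapping.single (Z (zc u)) 1"

text \<open>The action of \<open>T\<^sub>i\<^sub>,\<^sub>j\<^sub>,\<^sub>k \<mapsto> x\<^sub>i y\<^sub>j z\<^sub>k\<close> on monomials.  Reading the exponent vector as a multiset avoids
  multiples of exponent vectors by natural numbers.\<close>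

definition toric :: "point mono \<Rightarrow> xyz mono" where
  "toric m = (\<Sum>u\<in>#inv mon m. xyz_exponent u)"

lemma toric_mon: "toric (mon M) = (\<Sum>u\<in>#M. xyz_exponent u)"
  by (simp add: toric_def inv_f_f[OF inj_mon])

lemma toric_add: "toric (m + n) = toric m + toric n"
proof -
  obtain M N where "m = mon M" "n = mon N" by (metis mon_surj)
  then show ?thesis by (simp add: toric_mon mon_union[symmetric])
qed

lemma toric_mon_eq_iff: "toric (mon M) = toric (mon N) \<longleftrightarrow> same_marginals M N"
proof -
  have X: "Poly_Mapping.lookup (toric (mon L)) (X i) = count (image_mset xc L) i"
    and Y: "Poly_Mapping.lookup (toric (mon L)) (Y i) = count (image_mset yc L) i"
    and Z: "Poly_Mapping.lookup (toric (mon L)) (Z i) = count (image_mset zc L) i" for L i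
    by (induction L) (auto simp: toric_mon xyz_exponent_def lookup_add lookup_single when_def)
  show ?thesis
  proof
    assume "toric (mon M) = toric (mon N)"
    then show "same_marginals M N"
      unfolding same_marginals_def by (metis X Y Z multiset_eqI)
  next
    assume "same_marginals M N"
    then have eq: "image_mset xc M = image_mset xc N" "image_mset yc M = image_mset yc N"
      "image_mset zc M = image_mset zc N" by (auto simp: same_marginals_def)
    show "toric (mon M) = toric (mon N)"
    proof (rule poly_mapping_eqI)
      show "Poly_Mapping.lookup (toric (mon M)) w = Poly_Mapping.lookup (toric (mon N)) w" for w
        using X Y Z eq by (cases w) simp_all
    qed
  qed
qed

text \<open>The substitution sends monomials to monomials, so that its kernel can be studied one fiber of
  \<open>toric\<close> at a time.\<close>

lemma eval_hom_xyz:
  fixes p :: "(point, 'k::comm_ring_1) mpoly"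
  shows "eval_hom xyz_mono p =
    (\<Sum>m\<in>Poly_Mapping.keys p. Poly_Mapping.single (toric m) (Poly_Mapping.lookup p m))"
  unfolding eval_hom_def
proof (rule sum.cong[OF refl])
  fix m :: "point mono"
  obtain M where m: "m = mon M" by (rule mon_surj)
  have xyz: "xyz_mono u = Poly_Mapping.single (xyz_exponent u) (1::'k)" for u
    by (cases u) (simp add: xyz_mono_def var_def xyz_exponent_def mult_single)
  have "(\<Prod>u\<in>#L. xyz_mono u) = Poly_Mapping.single (toric (mon L)) (1::'k)" for L
    by (induction L) (simp_all add: toric_mon xyz mult_single)
  then have "(\<Prod>v\<in>Poly_Mapping.keys m. xyz_mono v ^ Poly_Mapping.lookup m v)
      = Poly_Mapping.single (toric m) (1::'k)"
    unfolding m keys_mon lookup_mon image_prod_mset_multiplicity[symmetric] .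
  then show "const (Poly_Mapping.lookup p m) *
      (\<Prod>v\<in>Poly_Mapping.keys m. xyz_mono v ^ Poly_Mapping.lookup m v) =
      Poly_Mapping.single (toric m) (Poly_Mapping.lookup p m)"
    by (simp add: const_def mult_single)
qed

lemma lookup_eval_hom_xyz:
  "Poly_Mapping.lookup (eval_hom xyz_mono p) c =
    (\<Sum>m | m \<in> Poly_Mapping.keys p \<and> toric m = c. Poly_Mapping.lookup p m)"
  unfolding eval_hom_xyz lookup_sum
  by (subst Collect_conj_eq, subst Collect_mem_eq)
    (auto simp: lookup_single when_def sum.inter_restrict intro!: sum.cong)

lemma eval_hom_xyz_superset:
  assumes "finite S" "Poly_Mapping.keys p \<subseteq> S"
  shows "eval_hom xyz_mono p = (\<Sum>m\<in>S. Poly_Mapping.single (toric m) (Poly_Mapping.lookup p m))"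
  unfolding eval_hom_xyz
  by (rule sum.mono_neutral_left) (use assms in \<open>auto simp: in_keys_iff\<close>)

lemma eval_hom_xyz_add: "eval_hom xyz_mono (p + q) = eval_hom xyz_mono p + eval_hom xyz_mono q"
proof -
  let ?S = "Poly_Mapping.keys p \<union> Poly_Mapping.keys q"
  have "Poly_Mapping.keys (p + q) \<subseteq> ?S" by (rule keys_add)
  then show ?thesis
    by (simp add: eval_hom_xyz_superset[of ?S] lookup_add single_add sum.distrib)
qed

lemma eval_hom_xyz_sum: "eval_hom xyz_mono (\<Sum>i\<in>S. f i) = (\<Sum>i\<in>S. eval_hom xyz_mono (f i))"
  by (induction S rule: infinite_finite_induct) (simp_all add: eval_hom_xyz_add, simp_all add: eval_hom_xyz)

lemma eval_hom_xyz_single: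
  "eval_hom xyz_mono (Poly_Mapping.single m c) = Poly_Mapping.single (toric m) c"
  by (subst eval_hom_xyz_superset[of "{m}"]) auto

lemma poly_sum_terms:
  "(\<Sum>m\<in>Poly_Mapping.keys p. Poly_Mapping.single m (Poly_Mapping.lookup p m)) = p"
  by (rule poly_mapping_eqI) (simp add: lookup_sum lookup_single when_def in_keys_iff)

lemma eval_hom_xyz_mult: "eval_hom xyz_mono (p * q) = eval_hom xyz_mono p * eval_hom xyz_mono q"
proof -
  have "p * q = (\<Sum>m\<in>Poly_Mapping.keys p. \<Sum>n\<in>Poly_Mapping.keys q.
      Poly_Mapping.single (m + n) (Poly_Mapping.lookup p m * Poly_Mapping.lookup q n))"
    by (subst (1) poly_sum_terms[of p, symmetric], subst (1) poly_sum_terms[of q, symmetric])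
      (simp add: sum_product mult_single)
  then show ?thesis
    by (simp add: eval_hom_xyz_sum eval_hom_xyz_single toric_add)
      (simp add: eval_hom_xyz sum_product mult_single)
qed

section \<open>Generated ideals\<close>

lemma polys_over_add: "p \<in> polys_over V \<Longrightarrow> q \<in> polys_over V \<Longrightarrow> p + q \<in> polys_over V"
  using keys_add[of p q] by (auto simp: polys_over_def)

lemma zero_in_polys_over: "0 \<in> polys_over V"
  by (simp add: polys_over_def)

lemma polys_over_sum: "(\<And>i. i \<in> S \<Longrightarrow> f i \<in> polys_over V) \<Longrightarrow> (\<Sum>i\<in>S. f i) \<in> polys_over V"
  by (induction S rule: infinite_finite_induct) (auto intro: polys_over_add simp: zero_in_polys_over)

lemma polys_over_mult:
  assumes "p \<in> polys_over V" "q \<in> polys_over V"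
  shows "p * q \<in> polys_over V"
  unfolding polys_over_def mem_Collect_eq
proof
  fix m assume "m \<in> Poly_Mapping.keys (p * q)"
  then obtain s t where "s \<in> Poly_Mapping.keys p" "t \<in> Poly_Mapping.keys q" "m = s + t"
    using keys_mult[of p q] by blast
  moreover from this have "Poly_Mapping.keys s \<subseteq> V" "Poly_Mapping.keys t \<subseteq> V"
    using assms by (simp_all add: polys_over_def)
  ultimately show "Poly_Mapping.keys m \<subseteq> V" using keys_add[of s t] by blast
qed

lemma single_in_polys_over: "Poly_Mapping.keys m \<subseteq> V \<Longrightarrow> Poly_Mapping.single m c \<in> polys_over V"
  by (simp add: polys_over_def)

lemma ideal_gen_sumI:
  assumes "finite S" "\<And>i. i \<in> S \<Longrightarrow> q i \<in> polys_over V" "\<And>i. i \<in> S \<Longrightarrow> b i \<in> B"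
  shows "(\<Sum>i\<in>S. q i * b i) \<in> ideal_gen V B"
proof -
  have "(\<Sum>i\<in>S. q i * b i) = (\<Sum>c\<in>b ` S. (\<Sum>i | i \<in> S \<and> b i = c. q i) * c)"
    by (subst sum.image_gen[OF assms(1), of _ b]) (auto simp: sum_distrib_right intro!: sum.cong)
  moreover have "(\<Sum>i | i \<in> S \<and> b i = c. q i) \<in> polys_over V" for c
    by (rule polys_over_sum) (use assms(2) in auto)
  ultimately show ?thesis
    unfolding ideal_gen_def using assms(1,3) by (auto intro!: exI[of _ "b ` S"])
qed

lemma ideal_gen_mono: "B \<subseteq> C \<Longrightarrow> ideal_gen V B \<subseteq> ideal_gen V C"
  by (auto simp: ideal_gen_def)

lemma ideal_gen_multiples:
  assumes "\<And>b. b \<in> B \<Longrightarrow> \<exists>r c. r \<in> polys_over V \<and> c \<in> C \<and> b = r * c"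
  shows "ideal_gen V B \<subseteq> ideal_gen V C"
proof
  fix f assume "f \<in> ideal_gen V B"
  then obtain A q where A: "finite A" "A \<subseteq> B" "\<forall>b\<in>A. q b \<in> polys_over V" and f: "f = (\<Sum>b\<in>A. q b * b)"
    by (auto simp: ideal_gen_def)
  obtain r c where rc: "\<And>b. b \<in> B \<Longrightarrow> r b \<in> polys_over V \<and> c b \<in> C \<and> b = r b * c b"
    using assms by metis
  have "f = (\<Sum>b\<in>A. (q b * r b) * c b)"
    unfolding f using rc A(2) by (intro sum.cong) (auto simp: mult.assoc)
  then show "f \<in> ideal_gen V C"
    using A rc by (auto intro!: ideal_gen_sumI polys_over_mult)
qed

text \<open>Divisibility of each leading monomial of \<open>I\<close> by one of \<open>G\<close> suffices: the quotient divides \<open>lead_mono f\<close>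
  and hence stays in the variables \<open>V\<close>, as \<open>ideal_gen\<close> demands of cofactors.\<close>

lemma groebner_basisI:
  fixes I :: "('v::linorder, 'k::comm_ring_1) mpoly set"
  assumes "finite G" "G \<subseteq> I" "0 \<notin> G" and I: "I \<subseteq> polys_over V"
    and dvd: "\<And>f. f \<in> I \<Longrightarrow> f \<noteq> 0 \<Longrightarrow> \<exists>g\<in>G. mono_dvd (lead_mono g) (lead_mono f)"
  shows "groebner_basis V I G"
proof -
  have "initial_ideal V I \<subseteq> ideal_gen V {Poly_Mapping.single (lead_mono g) 1 | g. g \<in> G}"
    unfolding initial_ideal_def
  proof (rule ideal_gen_multiples)
    fix b assume "b \<in> {Poly_Mapping.single (lead_mono f) (1::'k) | f. f \<in> I \<and> f \<noteq> 0}"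
    then obtain f where f: "f \<in> I" "f \<noteq> 0" and b: "b = Poly_Mapping.single (lead_mono f) 1" by blast
    obtain g r where g: "g \<in> G" and r: "lead_mono f = lead_mono g + r"
      using dvd[OF f] by (auto simp: mono_dvd_def)
    have "Poly_Mapping.keys r \<subseteq> Poly_Mapping.keys (lead_mono f)"
      unfolding r by (auto simp: in_keys_iff lookup_add)
    also have "\<dots> \<subseteq> V" using I f lead_mono_in_keys[OF f(2)] by (auto simp: polys_over_def)
    finally have "Poly_Mapping.single r (1::'k) \<in> polys_over V" by (rule single_in_polys_over)
    moreover have "b = Poly_Mapping.single r 1 * Poly_Mapping.single (lead_mono g) 1"
      unfolding b r by (simp add: mult_single add.commute)
    ultimately show "\<exists>r c. r \<in> polys_over V \<and>
        c \<in> {Poly_Mapping.single (lead_mono g) 1 | g. g \<in> G} \<and> b = r * c"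
      using g by blast
  qed
  moreover have "ideal_gen V {Poly_Mapping.single (lead_mono g) (1::'k) | g. g \<in> G} \<subseteq> initial_ideal V I"
    unfolding initial_ideal_def by (rule ideal_gen_mono) (use assms(2,3) in auto)
  ultimately show ?thesis using assms(1-3) by (auto simp: groebner_basis_def)
qed

text \<open>The initial ideal of \<open>I\<close> is squeezed between the ideal of the leading monomials of \<open>G\<close> and the initial
  ideal of \<open>J\<close>, which coincide.\<close>

lemma groebner_basis_subideal:
  assumes "groebner_basis V J G" "G \<subseteq> I" "I \<subseteq> J"
  shows "groebner_basis V I G"
proof -
  have "initial_ideal V I \<subseteq> initial_ideal V J"
    unfolding initial_ideal_def using assms(3) by (intro ideal_gen_mono) auto
  moreover have "ideal_gen V {Poly_Mapping.single (lead_mono g) 1 | g. g \<in> G} \<subseteq> initial_ideal V I"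
    unfolding initial_ideal_def
    using assms(1,2) by (intro ideal_gen_mono) (auto simp: groebner_basis_def)
  ultimately show ?thesis using assms by (auto simp: groebner_basis_def)
qed

section \<open>Two-minors and quadratic fiber binomials\<close>

abbreviation pure_binomial :: "'v mono \<Rightarrow> 'v mono \<Rightarrow> ('v, 'k::comm_ring_1) mpoly" where
  "pure_binomial s t \<equiv> Poly_Mapping.single s 1 - Poly_Mapping.single t 1"

lemma var_mult_var: "var u * var v = (Poly_Mapping.single (mon {#u, v#}) 1 :: ('v, 'k::comm_ring_1) mpoly)"
  by (simp add: var_def mult_single mon_def)

lemma pair_mset_eq_iff: "{#a, b#} = {#c, d#} \<longleftrightarrow> a = c \<and> b = d \<or> a = d \<and> b = c"
  by (auto simp: add_eq_conv_ex)

lemma size_2_mset: "size M = 2 \<Longrightarrow> \<exists>u v. M = {#u, v#}"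
  by (metis One_nat_def Suc_1 size_1_singleton_mset size_eq_Suc_imp_eq_union size_add_mset nat.inject)

lemma same_marginals_size: "same_marginals M N \<Longrightarrow> size M = size N"
  unfolding same_marginals_def by (metis size_image_mset)

text \<open>A product of two variables can be rearranged in its fiber only by exchanging coordinates, and up to the
  order of the factors every exchange is an exchange of a single coordinate: exchanging two of the three
  is the same as exchanging the third.  The zero minors correspond to \<open>S = T\<close>.\<close>

lemma minors_eq_binomials:
  "(\<Union>u\<in>D. \<Union>v\<in>D. {minor_x D u v, minor_y D u v, minor_z D u v :: (point, 'k::comm_ring_1) mpoly}) =
    {pure_binomial (mon S) (mon T) | S T. set_mset S \<subseteq> D \<and> set_mset T \<subseteq> D \<and> size S = 2 \<and> same_marginals S T}"
  (is "?M = ?B")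
proof
  have B: "pure_binomial (mon S) (mon T) \<in> ?B"
    if "set_mset S \<subseteq> D" "set_mset T \<subseteq> D" "size S = 2" "same_marginals S T" for S T
    using that by blast
  show "?M \<subseteq> ?B"
  proof
    fix b assume "b \<in> ?M"
    then obtain i1 j1 k1 i2 j2 k2 where uv: "(i1, j1, k1) \<in> D" "(i2, j2, k2) \<in> D"
      and b: "b = minor_x D (i1, j1, k1) (i2, j2, k2) \<or> b = minor_y D (i1, j1, k1) (i2, j2, k2) \<or>
        b = minor_z D (i1, j1, k1) (i2, j2, k2)"
      by auto
    let ?S = "{#(i1, j1, k1), (i2, j2, k2)#}"
    have zero: "0 \<in> ?B" using B[of ?S ?S] uv by (simp add: same_marginals_def)
    from b show "b \<in> ?B"
      using zero uv B[of ?S "{#(i2, j1, k1), (i1, j2, k2)#}"]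
        B[of ?S "{#(i1, j2, k1), (i2, j1, k2)#}"] B[of ?S "{#(i1, j1, k2), (i2, j2, k1)#}"]
      by (elim disjE)
        (simp_all add: minor_x_def minor_y_def minor_z_def var_mult_var same_marginals_def add_mset_commute)
  qed
  show "?B \<subseteq> ?M"
  proof
    fix b assume "b \<in> ?B"
    then obtain S T where S: "set_mset S \<subseteq> D" "size S = 2" and T: "set_mset T \<subseteq> D"
      and eq: "same_marginals S T" and b: "b = pure_binomial (mon S) (mon T)" by blast
    obtain u v where uv: "S = {#u, v#}" using S(2) by (blast dest: size_2_mset)
    have "size T = 2" using same_marginals_size[OF eq] S(2) by simp
    then obtain p q where pq: "T = {#p, q#}" by (blast dest: size_2_mset)
    have "xc u = xc p \<and> xc v = xc q \<or> xc u = xc q \<and> xc v = xc p"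
      using eq unfolding uv pq same_marginals_def by (simp add: pair_mset_eq_iff)
    then obtain u' v' where uv': "T = {#u', v'#}" and x: "xc u = xc u'" "xc v = xc v'"
      using pq add_mset_commute by metis
    obtain i1 j1 k1 i2 j2 k2 where u: "u = (i1, j1, k1)" and v: "v = (i2, j2, k2)"
      by (cases u, cases v)
    obtain j1' k1' j2' k2' where u': "u' = (i1, j1', k1')" and v': "v' = (i2, j2', k2')"
      using x u v by (cases u', cases v') auto
    have y: "j1' = j1 \<and> j2' = j2 \<or> j1' = j2 \<and> j2' = j1"
      and z: "k1' = k1 \<and> k2' = k2 \<or> k1' = k2 \<and> k2' = k1"
      using eq unfolding uv uv' u v u' v' same_marginals_def by (auto simp: pair_mset_eq_iff)
    have D: "u \<in> D" "v \<in> D" "u' \<in> D" "v' \<in> D" using S T uv uv' by auto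
    have b: "b = var u * var v - var u' * var v'" unfolding b uv uv' var_mult_var ..
    have "minor_x D u u = (0 :: (point, 'k) mpoly)" by (simp add: minor_x_def u)
    then have "b = minor_x D u u \<or> b = minor_x D u v \<or> b = minor_y D u v \<or> b = minor_z D u v"
      using y z D unfolding b u v u' v'
      by (elim disjE conjE) (simp_all add: minor_x_def minor_y_def minor_z_def mult.commute)
    then show "b \<in> ?M" using D(1,2) by blast
  qed
qed

lemma keys_binomial: "s \<noteq> t \<Longrightarrow> Poly_Mapping.keys (pure_binomial s t :: ('v, 'k::comm_ring_1) mpoly) = {s, t}"
  by (auto simp: in_keys_iff lookup_minus lookup_single when_def split: if_splits)

lemma lead_mono_binomial:
  "t < s \<Longrightarrow> lead_mono (pure_binomial s t :: ('v::linorder, 'k::comm_ring_1) mpoly) = s"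
  by (simp add: lead_mono_def keys_binomial max_absorb1)

lemma lead_cf_binomial:
  "t < s \<Longrightarrow> lead_cf (pure_binomial s t :: ('v::linorder, 'k::comm_ring_1) mpoly) = 1"
  by (simp add: lead_cf_def lead_mono_binomial lookup_minus lookup_single when_def)

lemma binomial_in_special_fiber_ideal:
  assumes "set_mset S \<subseteq> D" "set_mset T \<subseteq> D" "same_marginals S T"
  shows "(pure_binomial (mon S) (mon T) :: (point, 'k::comm_ring_1) mpoly) \<in> special_fiber_ideal D"
proof -
  let ?b = "Poly_Mapping.single (mon S) 1 + Poly_Mapping.single (mon T) (-1) :: (point, 'k) mpoly"
  have eq: "pure_binomial (mon S) (mon T) = ?b"
    by (simp add: single_uminus)
  have "?b \<in> polys_over D"
    by (intro polys_over_add single_in_polys_over) (simp_all add: keys_mon assms)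
  moreover have "eval_hom xyz_mono ?b = 0"
    using assms(3)[folded toric_mon_eq_iff]
    by (simp add: eval_hom_xyz_add eval_hom_xyz_single single_add[symmetric])
  ultimately show ?thesis unfolding eq special_fiber_ideal_def mem_Collect_eq by (rule conjI)
qed

lemma minors_ideal_subset: "minors_ideal D \<subseteq> special_fiber_ideal D"
proof
  fix f :: "(point, 'k::comm_ring_1) mpoly" assume "f \<in> minors_ideal D"
  then obtain A q where f: "f = (\<Sum>b\<in>A. q b * b)" and q: "\<forall>b\<in>A. q b \<in> polys_over D"
    and A: "A \<subseteq> {pure_binomial (mon S) (mon T) | S T.
      set_mset S \<subseteq> D \<and> set_mset T \<subseteq> D \<and> size S = 2 \<and> same_marginals S T}"
    unfolding minors_ideal_def minors_eq_binomials ideal_gen_def by auto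
  have b: "b \<in> special_fiber_ideal D" if "b \<in> A" for b
    using A that binomial_in_special_fiber_ideal by blast
  have "f \<in> polys_over D" unfolding f
    by (intro polys_over_sum polys_over_mult) (use q b in \<open>auto simp: special_fiber_ideal_def\<close>)
  moreover have "eval_hom xyz_mono f = 0" unfolding f
    using b by (simp add: eval_hom_xyz_sum eval_hom_xyz_mult special_fiber_ideal_def)
  ultimately show "f \<in> special_fiber_ideal D" by (simp add: special_fiber_ideal_def)
qed

lemma single_sum: "(\<Sum>i\<in>S. Poly_Mapping.single m (f i)) = Poly_Mapping.single m (\<Sum>i\<in>S. f i)"
  by (induction S rule: infinite_finite_induct) (simp_all add: single_add)

text \<open>The coefficients of an element of the kernel sum to zero over each fiber.  Replacing every monomial by a
  fixed representative of its fiber therefore yields zero, and the element is a combination of the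
  differences, which are minors in degree two.\<close>

lemma quadratic_in_minors_ideal:
  fixes g :: "(point, 'k::comm_ring_1) mpoly"
  assumes g: "g \<in> special_fiber_ideal D" and quad: "quadratic g"
  shows "g \<in> minors_ideal D"
proof -
  let ?K = "Poly_Mapping.keys g" and ?c = "Poly_Mapping.lookup g"
  define r where "r c = (SOME m. m \<in> ?K \<and> toric m = c)" for c
  have r: "r (toric m) \<in> ?K \<and> toric (r (toric m)) = toric m" if "m \<in> ?K" for m
    unfolding r_def by (rule someI[of _ m]) (use that in simp)
  have sum0: "(\<Sum>m | m \<in> ?K \<and> toric m = c. ?c m) = 0" for c
    using g lookup_eval_hom_xyz[of g c] by (simp add: special_fiber_ideal_def)
  have "(\<Sum>m\<in>?K. Poly_Mapping.single (r (toric m)) (?c m)) =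
      (\<Sum>c\<in>toric ` ?K. \<Sum>m | m \<in> ?K \<and> toric m = c. Poly_Mapping.single (r (toric m)) (?c m))"
    by (rule sum.image_gen) simp
  also have "\<dots> = (\<Sum>c\<in>toric ` ?K. Poly_Mapping.single (r c) (\<Sum>m | m \<in> ?K \<and> toric m = c. ?c m))"
    unfolding single_sum[symmetric] by (intro sum.cong) auto
  also have "\<dots> = 0" by (simp only: sum0 single_zero sum.neutral_const)
  finally have zero: "(\<Sum>m\<in>?K. Poly_Mapping.single (r (toric m)) (?c m)) = 0" .
  have "g = (\<Sum>m\<in>?K. Poly_Mapping.single m (?c m))"
    by (rule poly_sum_terms[symmetric])
  also have "\<dots> = (\<Sum>m\<in>?K. Poly_Mapping.single m (?c m) - Poly_Mapping.single (r (toric m)) (?c m))"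
    by (simp only: sum_subtractf zero diff_0_right)
  also have "\<dots> = (\<Sum>m\<in>?K. const (?c m) * pure_binomial m (r (toric m)))"
    by (simp add: const_def right_diff_distrib mult_single)
  also have "\<dots> \<in> minors_ideal D"
    unfolding minors_ideal_def
  proof (rule ideal_gen_sumI)
    show "const (?c m) \<in> polys_over D" for m by (simp add: const_def single_in_polys_over)
    fix m assume m: "m \<in> ?K"
    obtain S T where ST: "m = mon S" "r (toric m) = mon T" by (metis mon_surj)
    have over: "Poly_Mapping.keys n \<subseteq> D" if "n \<in> ?K" for n
      using g that by (simp add: special_fiber_ideal_def polys_over_def)
    have "set_mset S \<subseteq> D" "set_mset T \<subseteq> D"
      using over[OF m] over[OF conjunct1[OF r[OF m]]] unfolding ST(2) unfolding ST(1) keys_mon .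
    moreover have "mono_degree m = 2" using quad m by (simp add: quadratic_def)
    then have "size S = 2" by (simp add: ST(1) mono_degree_mon)
    moreover have "same_marginals S T"
      using r[OF m] unfolding ST(2) unfolding ST(1) toric_mon_eq_iff by (simp add: same_marginals_def)
    ultimately show "pure_binomial m (r (toric m)) \<in>
        (\<Union>u\<in>D. \<Union>v\<in>D. {minor_x D u v, minor_y D u v, minor_z D u v})"
      unfolding minors_eq_binomials ST(2) unfolding ST(1) by blast
  qed simp
  finally show ?thesis .
qed

text \<open>A quadratic reduced basis of the special fiber ideal consists of elements of the smaller 2-minors ideal
  and thus serves both ideals.\<close>

lemma lex_quadratic_minors_ideal:
  assumes "lex_quadratic D (special_fiber_ideal D :: (point, 'k::comm_ring_1) mpoly set)"
  shows "lex_quadratic D (minors_ideal D :: (point, 'k) mpoly set)"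
proof -
  obtain G :: "(point, 'k) mpoly set"
    where G: "reduced_groebner_basis D (special_fiber_ideal D) G" and quad: "\<forall>g\<in>G. quadratic g"
    using assms by (auto simp: lex_quadratic_def)
  have GB: "groebner_basis D (special_fiber_ideal D) G"
    using G by (simp add: reduced_groebner_basis_def minimal_groebner_basis_def)
  have "G \<subseteq> minors_ideal D"
    using GB quad quadratic_in_minors_ideal by (auto simp: groebner_basis_def)
  then have "groebner_basis D (minors_ideal D) G"
    by (rule groebner_basis_subideal[OF GB _ minors_ideal_subset])
  then have "reduced_groebner_basis D (minors_ideal D) G"
    using G by (simp add: reduced_groebner_basis_def minimal_groebner_basis_def)
  then show ?thesis using quad by (auto simp: lex_quadratic_def)
qed

section \<open>Minimal monomials of fibers\<close>

definition fiber :: "point set \<Rightarrow> point mono \<Rightarrow> point mono set" where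
  "fiber D m = {n. Poly_Mapping.keys n \<subseteq> D \<and> toric n = toric m}"

definition fiber_min :: "point set \<Rightarrow> point mono \<Rightarrow> point mono" where
  "fiber_min D m = Min (fiber D m)"

lemma mon_in_fiber_iff: "mon N \<in> fiber D (mon M) \<longleftrightarrow> set_mset N \<subseteq> D \<and> same_marginals N M"
  by (simp add: fiber_def keys_mon toric_mon_eq_iff)

lemma finite_multisets_of_size:
  assumes "finite D"
  shows "finite {M. set_mset M \<subseteq> D \<and> size M = n}"
proof (rule finite_subset)
  show "{M. set_mset M \<subseteq> D \<and> size M = n} \<subseteq> mset ` {xs. set xs \<subseteq> D \<and> length xs = n}"
  proof
    fix M assume "M \<in> {M. set_mset M \<subseteq> D \<and> size M = n}"
    moreover obtain xs where "M = mset xs" using ex_mset by metis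
    ultimately show "M \<in> mset ` {xs. set xs \<subseteq> D \<and> length xs = n}" by auto
  qed
qed (use finite_lists_length_eq[OF assms] in simp)

lemma finite_fiber:
  assumes "finite D"
  shows "finite (fiber D m)"
proof -
  obtain M where m: "m = mon M" by (rule mon_surj)
  have "fiber D m \<subseteq> mon ` {N. set_mset N \<subseteq> D \<and> size N = size M}"
  proof
    fix n assume n: "n \<in> fiber D m"
    obtain N where "n = mon N" by (rule mon_surj)
    then show "n \<in> mon ` {N. set_mset N \<subseteq> D \<and> size N = size M}"
      using n same_marginals_size[of N M] by (auto simp: m mon_in_fiber_iff)
  qed
  then show ?thesis
    by (rule finite_subset) (rule finite_imageI[OF finite_multisets_of_size[OF assms]])
qed

lemma fiber_min_in_fiber:
  assumes "finite D" "Poly_Mapping.keys m \<subseteq> D"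
  shows "fiber_min D m \<in> fiber D m"
  unfolding fiber_min_def by (rule Min_in[OF finite_fiber[OF assms(1)]]) (use assms in \<open>auto simp: fiber_def\<close>)

lemma fiber_min_le: "finite D \<Longrightarrow> n \<in> fiber D m \<Longrightarrow> fiber_min D m \<le> n"
  unfolding fiber_min_def by (rule Min_le[OF finite_fiber])

lemma fiber_min_cong: "toric m = toric n \<Longrightarrow> fiber_min D m = fiber_min D n"
  by (simp add: fiber_min_def fiber_def)

lemma pair_subset_mset: "u \<in># M \<Longrightarrow> v \<in># M \<Longrightarrow> u \<noteq> v \<Longrightarrow> {#u, v#} \<subseteq># M"
  by (metis in_diff_count insert_subset_eq_iff mset_subset_eq_single count_single gr_zeroI less_nat_zero_code not_in_iff)

text \<open>The replacements are those that motivate \<open>sorted_points\<close>.  They lower the monomial because the smaller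
  point \<open>u\<close>, that is, the larger of the two variables, disappears in favour of larger points.\<close>

lemma unsorted_pair_lowers:
  assumes D: "ferrers_diagram D" and M: "set_mset M \<subseteq> D" and uns: "\<not> sorted_points D M"
  obtains T T' where "T \<subseteq># M" "size T = 2" "set_mset T' \<subseteq> D" "same_marginals T' T" "mon T' < mon T"
proof -
  obtain u v where u: "u \<in># M" and v: "v \<in># M" and
    bad: "xc u = xc v \<and> yc u < yc v \<and> zc u < zc v \<or>
      xc u < xc v \<and> (xc u, max (yc u) (yc v), max (zc u) (zc v)) \<in> D \<and> \<not> (yc v \<le> yc u \<and> zc v \<le> zc u)"
    using uns unfolding sorted_points_def by blast
  obtain i j k i' j' k' where uv: "u = (i, j, k)" "v = (i', j', k')" by (cases u, cases v)
  have uD: "(i, j, k) \<in> D" and vD: "(i', j', k') \<in> D" using M u v by (auto simp: uv)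
  note pos = ferrers_diagram_pos[OF D uD] ferrers_diagram_pos[OF D vD]
  have sub: "{#u, v#} \<subseteq># M" using bad by (intro pair_subset_mset u v) (auto simp: uv)
  from bad consider "i = i'" "j < j'" "k < k'" |
    "i < i'" "(i, max j j', max k k') \<in> D" "\<not> (j' \<le> j \<and> k' \<le> k)" by (auto simp: uv)
  then show ?thesis
  proof cases
    case 1
    show ?thesis
    proof (rule that[OF sub])
      show "set_mset {#(i, j, k'), (i, j', k)#} \<subseteq> D"
        using ferrers_diagram_down[OF D vD] pos 1 by simp
      show "mon {#(i, j, k'), (i, j', k)#} < mon {#u, v#}"
        by (rule mon_less_leading_point[of u]) (use 1 in \<open>auto simp: uv\<close>)
    qed (use 1 in \<open>simp_all add: uv same_marginals_def add_mset_commute\<close>)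
  next
    case 2
    show ?thesis
    proof (rule that[OF sub])
      have "(i', min j j', min k k') \<in> D"
        using ferrers_diagram_down[OF D vD] pos by simp
      then show "set_mset {#(i, max j j', max k k'), (i', min j j', min k k')#} \<subseteq> D"
        using 2 by simp
      show "mon {#(i, max j j', max k k'), (i', min j j', min k k')#} < mon {#u, v#}"
        by (rule mon_less_leading_point[of u]) (use 2 in \<open>auto simp: uv\<close>)
      show "same_marginals {#(i, max j j', max k k'), (i', min j j', min k k')#} {#u, v#}"
        by (simp add: uv same_marginals_def max_def min_def add_mset_commute)
    qed simp
  qed
qed

text \<open>The minimal monomial of a fiber is sorted, because a lowering swap of two variables lowers the whole
  monomial.  If \<open>M\<close> is sorted as well, uniqueness makes it the minimal one; otherwise a pair of its
  variables can be lowered on its own.\<close>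

lemma quadratic_divisor_of_nonminimal:
  assumes D: "ferrers_diagram D" "projection_property D"
    and M: "set_mset M \<subseteq> D" and nonmin: "fiber_min D (mon M) \<noteq> mon M"
  obtains T where "T \<subseteq># M" "size T = 2" "fiber_min D (mon T) \<noteq> mon T"
proof -
  have fin: "finite D" using D(1) by (simp add: ferrers_diagram_def)
  have "\<exists>T. T \<subseteq># M \<and> size T = 2 \<and> fiber_min D (mon T) \<noteq> mon T"
  proof (cases "sorted_points D M")
    case False
    obtain T T' where T: "T \<subseteq># M" "size T = 2" and T': "set_mset T' \<subseteq> D" "same_marginals T' T"
      and less: "mon T' < mon T"
      using unsorted_pair_lowers[OF D(1) M False] by blast
    have "fiber_min D (mon T) \<le> mon T'" using T' by (intro fiber_min_le fin) (simp add: mon_in_fiber_iff)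
    then show ?thesis using T less by (metis leD)
  next
    case True
    obtain N where N: "fiber_min D (mon M) = mon N" by (rule mon_surj)
    have NM: "set_mset N \<subseteq> D" "same_marginals N M"
      using fiber_min_in_fiber[OF fin, of "mon M"] M by (simp_all add: N keys_mon mon_in_fiber_iff)
    have "sorted_points D N"
    proof (rule ccontr)
      assume "\<not> sorted_points D N"
      then obtain T T' where T: "T \<subseteq># N" and T': "set_mset T' \<subseteq> D" "same_marginals T' T"
        and less: "mon T' < mon T"
        using unsorted_pair_lowers[OF D(1) NM(1)] by metis
      obtain R where R: "N = T + R" using T by (auto simp: subset_mset.le_iff_add)
      have "mon (T' + R) < mon N" using less by (simp add: R mon_union)
      moreover have "mon (T' + R) \<in> fiber D (mon M)"
        using NM T' by (simp add: mon_in_fiber_iff R same_marginals_def)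
      then have "mon N \<le> mon (T' + R)" unfolding N[symmetric] by (rule fiber_min_le[OF fin])
      ultimately show False by simp
    qed
    then have "N = M" using sorted_points_unique[OF D NM(1) _ M True NM(2)] by simp
    then show ?thesis using N nonmin by simp
  qed
  then show ?thesis using that by blast
qed

section \<open>Quadratic Groebner bases\<close>

text \<open>The basis consists of the differences \<open>t - fiber_min D t\<close> for the non-minimal products \<open>t\<close> of two
  variables.  A leading monomial of the special fiber ideal is never minimal in its fiber, since
  cancellation forces a second monomial of the same fiber, and is thus divisible by such a \<open>t\<close>.  The basis
  is reduced because its tails are minimal in their fibers.\<close>

lemma lex_quadratic_special_fiber_ideal:
  assumes D: "ferrers_diagram D" "projection_property D"
  shows "lex_quadratic D (special_fiber_ideal D :: (point, 'k::comm_ring_1) mpoly set)"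
proof -
  have fin: "finite D" using D(1) by (simp add: ferrers_diagram_def)
  define Q where "Q = {T. set_mset T \<subseteq> D \<and> size T = 2 \<and> fiber_min D (mon T) \<noteq> mon T}"
  define g :: "point multiset \<Rightarrow> (point, 'k) mpoly"
    where "g T = pure_binomial (mon T) (fiber_min D (mon T))" for T
  have tail: "\<exists>S. fiber_min D (mon T) = mon S \<and> set_mset S \<subseteq> D \<and> same_marginals T S \<and> size S = 2"
    if "T \<in> Q" for T
  proof -
    obtain S where S: "fiber_min D (mon T) = mon S" by (rule mon_surj)
    moreover have "set_mset S \<subseteq> D" "same_marginals S T"
      using fiber_min_in_fiber[OF fin, of "mon T"] that
      by (simp_all add: S Q_def keys_mon mon_in_fiber_iff)
    ultimately show ?thesis
      using that same_marginals_size[of S T] by (auto simp: Q_def same_marginals_def)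
  qed
  have less: "fiber_min D (mon T) < mon T" if "T \<in> Q" for T
    using fiber_min_le[OF fin, of "mon T" "mon T"] that
    by (auto simp: Q_def fiber_def keys_mon order.strict_iff_order)
  have keys: "Poly_Mapping.keys (g T) = {mon T, fiber_min D (mon T)}"
    and lead: "lead_mono (g T) = mon T" "lead_cf (g T) = 1" if "T \<in> Q" for T
    using less[OF that] by (simp_all add: g_def keys_binomial lead_mono_binomial lead_cf_binomial)
  have quad: "quadratic (g T)" if T: "T \<in> Q" for T
  proof -
    obtain S where "fiber_min D (mon T) = mon S" "size S = 2" using tail[OF T] by blast
    then show ?thesis
      using T keys[OF T] by (auto simp: quadratic_def mono_degree_mon Q_def)
  qed
  have GB: "groebner_basis D (special_fiber_ideal D) (g ` Q)"
  proof (rule groebner_basisI)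
    show "finite (g ` Q)"
      by (rule finite_imageI, rule finite_subset[OF _ finite_multisets_of_size[OF fin, of 2]]) (auto simp: Q_def)
    show "g ` Q \<subseteq> special_fiber_ideal D"
    proof
      fix h assume "h \<in> g ` Q"
      then obtain T where T: "T \<in> Q" "h = g T" by blast
      obtain S where "fiber_min D (mon T) = mon S" "set_mset S \<subseteq> D" "same_marginals T S"
        using tail[OF T(1)] by blast
      then show "h \<in> special_fiber_ideal D"
        using T by (auto simp: g_def Q_def intro: binomial_in_special_fiber_ideal)
    qed
    show "0 \<notin> g ` Q" using keys by fastforce
    show "special_fiber_ideal D \<subseteq> (polys_over D :: (point, 'k) mpoly set)"
      by (auto simp: special_fiber_ideal_def)
  next
    fix f :: "(point, 'k) mpoly"
    assume f: "f \<in> special_fiber_ideal D" "f \<noteq> 0"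
    obtain M where M: "lead_mono f = mon M" by (rule mon_surj)
    have key: "mon M \<in> Poly_Mapping.keys f" using lead_mono_in_keys[OF f(2)] by (simp add: M)
    have over: "Poly_Mapping.keys n \<subseteq> D" if "n \<in> Poly_Mapping.keys f" for n
      using f(1) that by (auto simp: special_fiber_ideal_def polys_over_def)
    have "\<exists>n\<in>Poly_Mapping.keys f. toric n = toric (mon M) \<and> n \<noteq> mon M"
    proof (rule ccontr)
      assume "\<not> ?thesis"
      then have "{n. n \<in> Poly_Mapping.keys f \<and> toric n = toric (mon M)} = {mon M}" using key by auto
      then have "Poly_Mapping.lookup f (mon M) = 0"
        using f(1) lookup_eval_hom_xyz[of f "toric (mon M)"] by (simp add: special_fiber_ideal_def)
      then show False using key by (simp add: in_keys_iff)
    qed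
    then obtain n where n: "n \<in> Poly_Mapping.keys f" "toric n = toric (mon M)" "n \<noteq> mon M" by blast
    have "n \<le> mon M" unfolding M[symmetric] lead_mono_def using n(1) by simp
    moreover have "fiber_min D (mon M) \<le> n" using n over by (intro fiber_min_le fin) (simp add: fiber_def)
    ultimately have "fiber_min D (mon M) \<noteq> mon M" using n(3) by auto
    moreover have MD: "set_mset M \<subseteq> D" using over[OF key] by (simp add: keys_mon)
    ultimately obtain T where T: "T \<subseteq># M" "size T = 2" "fiber_min D (mon T) \<noteq> mon T"
      using quadratic_divisor_of_nonminimal[OF D] by metis
    then have TQ: "T \<in> Q" using MD by (auto simp: Q_def dest: mset_subset_eqD)
    obtain R where "M = T + R" using T(1) by (auto simp: subset_mset.le_iff_add)
    then have "mono_dvd (lead_mono (g T)) (lead_mono f)"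
      by (auto simp: lead[OF TQ] M mon_union mono_dvd_def)
    then show "\<exists>h\<in>g ` Q. mono_dvd (lead_mono h) (lead_mono f)" using TQ by blast
  qed
  \<comment> \<open>A quadratic leading monomial divides a quadratic monomial only if they are equal.\<close>
  have irred: "S = T" if S: "S \<in> Q" and T: "T \<in> Q"
    and m: "m \<in> Poly_Mapping.keys (g T)" "mono_dvd (lead_mono (g S)) m" for S T m
  proof -
    obtain R where R: "fiber_min D (mon T) = mon R" "same_marginals T R" "size R = 2"
      using tail[OF T] by blast
    have "m = mon T \<or> m = mon R" using m(1) keys[OF T] R(1) by simp
    then show ?thesis
    proof
      assume "m = mon T"
      then show ?thesis using m(2) S T by (auto simp: lead[OF S] Q_def intro: mon_dvd_same_size)
    next
      assume "m = mon R"
      then have "S = R" using m(2) S R(3) by (auto simp: lead[OF S] Q_def intro: mon_dvd_same_size)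
      moreover have "fiber_min D (mon R) = mon R"
        using fiber_min_cong[of "mon T" "mon R" D] R by (simp add: toric_mon_eq_iff)
      ultimately show ?thesis using S by (simp add: Q_def)
    qed
  qed
  have "mon T \<in> Poly_Mapping.keys (g T)" if "T \<in> Q" for T using keys[OF that] by simp
  then have "minimal_groebner_basis D (special_fiber_ideal D) (g ` Q)"
    unfolding minimal_groebner_basis_def using GB lead irred by force
  then have "reduced_groebner_basis D (special_fiber_ideal D) (g ` Q)"
    unfolding reduced_groebner_basis_def using irred by blast
  then show ?thesis unfolding lex_quadratic_def using quad by blast
qed

theorem corollary2p14:
  fixes D :: "(nat \<times> nat \<times> nat) set"
  assumes "ferrers_diagram D"
    and "projection_property D \<or> lex_quadratic_diagram TYPE('k::field_char_0) D"
  shows "lex_quadratic D (minors_ideal D :: (nat \<times> nat \<times> nat, 'k) mpoly set)"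
proof (rule lex_quadratic_minors_ideal)
  show "lex_quadratic D (special_fiber_ideal D :: (point, 'k) mpoly set)"
    using assms lex_quadratic_special_fiber_ideal by (auto simp: lex_quadratic_diagram_def)
qed

end
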